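(* Let $H$ be a connected graph with $m$ edges which is edge-transitive (under its automorphism group), and let $(\phi_i)_{i=1}^d$ be a finite sequence of cut involutions of $H$ (each with its fixed left and right halves). Let $\chi:E(H)\to[m]$ be a rainbow (i.e. bijective) edge-colouring. If the Cauchy–Schwarz tree associated with $(\phi_i)_{i=1}^d$ rooted at $\chi$ contains a leaf labelled with a monochromatic colouring, then $H$ is weakly norming.
   Context: For a connected graph $H$, a cut involution is an automorphism $\phi$ of $H$ with $\phi=\phi^{-1}$ whose fixed point set $F_\phi=\{v:\phi(v)=v\}$ is a vertex cut (removing it disconnects $H$). For each cut involution $\phi$ a pair of disjoint sets $L_\phi,R_\phi$ partitioning $V(H)\setminus F_\phi$ is fixed, each a union of connected components of $H\setminus F_\phi$, with $\phi(L_\phi)=R_\phi$. The left-folding map is $\phi^+(v)=\phi(v)$ for $v\in R_\phi$ and $\phi^+(v)=v$ for $v\in L_\phi\cup F_\phi$; the right-folding map $\phi^-$ is defined with the roles of $L_\phi$ and $R_\phi$ swapped. For an edge-colouring $\chi$ of $H$, $\chi\circ\phi^{\pm}$ is the colouring giving edge $uv$ the colour $\chi(\phi^{\pm}(u)\phi^{\pm}(v))$. The Cauchy–Schwarz tree associated with $(\phi_i)_{i=1}^d$ rooted at $\chi_0$ is the rooted binary tree of depth $d$ whose vertices are labelled by edge-colourings: the root is labelled $\chi_0$ and each vertex at depth $i<d$ labelled $\chi$ has two children labelled $\chi\circ\phi_{i+1}^+$ and $\chi\circ\phi_{i+1}^-$. Weakly norming: with $\|f\|_{r(H)}:=\left(\int\prod_{ij\in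 E(H)}|f(x_i,x_j)|\,d\mu^{|V(H)|}\right)^{1/|E(H)|}$ ($\mu$ Lebesgue measure, one variable per vertex of $H$, vertex set $\{1,\dots,n\}$), $H$ is weakly norming if $\|\cdot\|_{r(H)}$ is a norm on bounded measurable functions $[0,1]^2\to\mathbb{R}$. *)

theory Defs
  imports "HOL-Analysis.Analysis"
begin

section \<open>Finite simple graphs\<close>

text \<open>A graph is given by its vertex set \<open>V\<close> and its set \<open>E\<close> of edges, each edge being the
  two-element set of its ends.\<close>

definition simple_graph :: "'a set \<Rightarrow> 'a set set \<Rightarrow> bool" where
  "simple_graph V E \<longleftrightarrow>
     finite V \<and> (\<forall>e\<in>E. \<exists>u\<in>V. \<exists>v\<in>V. u \<noteq> v \<and> e = {u, v})"

definition adj :: "'a set set \<Rightarrow> ('a \<times> 'a) set" where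
  "adj E = {(u, v). {u, v} \<in> E}"

definition graph_connected :: "'a set \<Rightarrow> 'a set set \<Rightarrow> bool" where
  "graph_connected V E \<longleftrightarrow> V \<noteq> {} \<and> (\<forall>u\<in>V. \<forall>v\<in>V. (u, v) \<in> (adj E)\<^sup>*)"

definition graph_components :: "'a set \<Rightarrow> 'a set set \<Rightarrow> 'a set set" where
  "graph_components V E = (\<lambda>u. {v \<in> V. (u, v) \<in> (adj E)\<^sup>*}) ` V"

text \<open>The graph with the vertices in \<open>F\<close> removed has vertex set \<open>V - F\<close> and the following
  edges.\<close>

definition remaining_edges :: "'a set set \<Rightarrow> 'a set \<Rightarrow> 'a set set" where
  "remaining_edges E F = {e \<in> E. e \<inter> F = {}}"

text \<open>The empty graph does not count as disconnected, so \<open>F = V\<close> is not a vertex cut; in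
  particular the identity will not be a cut involution.\<close>

definition vertex_cut :: "'a set \<Rightarrow> 'a set set \<Rightarrow> 'a set \<Rightarrow> bool" where
  "vertex_cut V E F \<longleftrightarrow>
     F \<subseteq> V \<and> V - F \<noteq> {} \<and> \<not> graph_connected (V - F) (remaining_edges E F)"

text \<open>Automorphisms are functions on the whole type; their values outside \<open>V\<close> are irrelevant.\<close>

definition graph_automorphism :: "'a set \<Rightarrow> 'a set set \<Rightarrow> ('a \<Rightarrow> 'a) \<Rightarrow> bool" where
  "graph_automorphism V E \<phi> \<longleftrightarrow>
     bij_betw \<phi> V V \<and> (\<forall>u\<in>V. \<forall>v\<in>V. {u, v} \<in> E \<longleftrightarrow> {\<phi> u, \<phi> v} \<in> E)"

definition edge_transitive :: "'a set \<Rightarrow> 'a set set \<Rightarrow> bool" where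
  "edge_transitive V E \<longleftrightarrow>
     (\<forall>e\<in>E. \<forall>e'\<in>E. \<exists>\<phi>. graph_automorphism V E \<phi> \<and> \<phi> ` e = e')"

section \<open>Cut involutions and folding maps\<close>

definition fixed_set :: "'a set \<Rightarrow> ('a \<Rightarrow> 'a) \<Rightarrow> 'a set" where
  "fixed_set V \<phi> = {v \<in> V. \<phi> v = v}"

definition cut_involution :: "'a set \<Rightarrow> 'a set set \<Rightarrow> ('a \<Rightarrow> 'a) \<Rightarrow> bool" where
  "cut_involution V E \<phi> \<longleftrightarrow>
     graph_automorphism V E \<phi> \<and> (\<forall>v\<in>V. \<phi> (\<phi> v) = v) \<and> vertex_cut V E (fixed_set V \<phi>)"

definition folding_halves ::
    "'a set \<Rightarrow> 'a set set \<Rightarrow> ('a \<Rightarrow> 'a) \<Rightarrow> 'a set \<Rightarrow> 'a set \<Rightarrow> bool" where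
  "folding_halves V E \<phi> L R \<longleftrightarrow>
     (let F = fixed_set V \<phi>; \<C> = graph_components (V - F) (remaining_edges E F) in
       L \<inter> R = {} \<and> L \<union> R = V - F \<and>
       (\<exists>\<A>\<subseteq>\<C>. L = \<Union>\<A>) \<and> (\<exists>\<B>\<subseteq>\<C>. R = \<Union>\<B>) \<and> \<phi> ` L = R)"

text \<open>\<open>fold_away \<phi> R\<close> is the left-folding map $\phi^+$ and \<open>fold_away \<phi> L\<close> is the right-folding
  map $\phi^-$.\<close>

definition fold_away :: "('a \<Rightarrow> 'a) \<Rightarrow> 'a set \<Rightarrow> 'a \<Rightarrow> 'a" where
  "fold_away \<phi> A v = (if v \<in> A then \<phi> v else v)"

section \<open>Edge-colourings and the Cauchy--Schwarz tree\<close>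

text \<open>An edge-colouring is a function on sets of vertices, of which only the values on \<open>E\<close>
  matter. Pulling back along a vertex map \<open>f\<close> gives the edge \<open>{u, v}\<close> the colour of
  \<open>f ` {u, v} = {f u, f v}\<close>.\<close>

definition pull_colouring :: "('a set \<Rightarrow> 'c) \<Rightarrow> ('a \<Rightarrow> 'a) \<Rightarrow> 'a set \<Rightarrow> 'c" where
  "pull_colouring \<kappa> f e = \<kappa> (f ` e)"

definition rainbow :: "'a set set \<Rightarrow> nat \<Rightarrow> ('a set \<Rightarrow> nat) \<Rightarrow> bool" where
  "rainbow E m \<kappa> \<longleftrightarrow> bij_betw \<kappa> E {1..m}"

text \<open>Exactly one colour is used; so there is no monochromatic colouring of the empty edge
  set.\<close>

definition monochromatic :: "'a set set \<Rightarrow> ('a set \<Rightarrow> 'c) \<Rightarrow> bool" where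
  "monochromatic E \<kappa> \<longleftrightarrow> (\<exists>c. \<kappa> ` E = {c})"

datatype 'b labelled_tree =
  TLeaf 'b
| TNode 'b "'b labelled_tree" "'b labelled_tree"

primrec leaf_labels :: "'b labelled_tree \<Rightarrow> 'b set" where
  "leaf_labels (TLeaf x) = {x}"
| "leaf_labels (TNode x l r) = leaf_labels l \<union> leaf_labels r"

text \<open>The arguments \<open>L\<close> and \<open>R\<close> are the assignments $\phi \mapsto L_\phi$ and
  $\phi \mapsto R_\phi$.\<close>

primrec cauchy_schwarz_tree ::
    "(('a \<Rightarrow> 'a) \<Rightarrow> 'a set) \<Rightarrow> (('a \<Rightarrow> 'a) \<Rightarrow> 'a set) \<Rightarrow> ('a \<Rightarrow> 'a) list \<Rightarrow>
     ('a set \<Rightarrow> 'c) \<Rightarrow> ('a set \<Rightarrow> 'c) labelled_tree" where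
  "cauchy_schwarz_tree L R [] \<kappa> = TLeaf \<kappa>"
| "cauchy_schwarz_tree L R (\<phi> # \<phi>s) \<kappa> =
     TNode \<kappa>
       (cauchy_schwarz_tree L R \<phi>s (pull_colouring \<kappa> (fold_away \<phi> (R \<phi>))))
       (cauchy_schwarz_tree L R \<phi>s (pull_colouring \<kappa> (fold_away \<phi> (L \<phi>))))"

section \<open>Weakly norming graphs\<close>

text \<open>Functions on the unit square are represented by functions on the plane, whose values
  outside the square are irrelevant. Measurable means Lebesgue measurable.\<close>

definition unit_square :: "(real \<times> real) set" where
  "unit_square = {0..1} \<times> {0..1}"

definition bounded_measurable :: "(real \<times> real \<Rightarrow> real) set" where
  "bounded_measurable =
     {f. f \<in> borel_measurable (lebesgue_on unit_square) \<and> bounded (f ` unit_square)}"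

text \<open>Lebesgue measure on the cube of points $(x_v)_{v \in V}$. The completion is what makes
  \<open>\<lambda>x. f (x u, x v)\<close> measurable for every Lebesgue measurable \<open>f\<close>.\<close>

definition cube_measure :: "'a set \<Rightarrow> ('a \<Rightarrow> real) measure" where
  "cube_measure V = completion (\<Pi>\<^sub>M v\<in>V. restrict_space lborel {0..1})"

text \<open>For a function \<open>f\<close> that is not symmetric, the factor $|f(x_i, x_j)|$ of an edge \<open>ij\<close>
  depends on which end is listed first. The edges are therefore read as ordered pairs by means
  of an orientation \<open>D\<close>.\<close>

definition orientation :: "'a set set \<Rightarrow> ('a \<times> 'a) set \<Rightarrow> bool" where
  "orientation E D \<longleftrightarrow> bij_betw (\<lambda>(u, v). {u, v}) D E"

definition r_norm ::
    "'a set \<Rightarrow> 'a set set \<Rightarrow> ('a \<times> 'a) set \<Rightarrow> (real \<times> real \<Rightarrow> real) \<Rightarrow> real" where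
  "r_norm V E D f =
     (LINT x|cube_measure V. (\<Prod>(i, j)\<in>D. \<bar>f (x i, x j)\<bar>)) powr (1 / real (card E))"

text \<open>As usual for function spaces, functions that agree almost everywhere are identified, so
  definiteness says that exactly the functions vanishing almost everywhere have norm zero.\<close>

definition is_norm_on_bounded_measurable :: "((real \<times> real \<Rightarrow> real) \<Rightarrow> real) \<Rightarrow> bool" where
  "is_norm_on_bounded_measurable N \<longleftrightarrow>
     (\<forall>f\<in>bounded_measurable. 0 \<le> N f) \<and>
     (\<forall>f\<in>bounded_measurable. N f = 0 \<longleftrightarrow> (AE p in lebesgue_on unit_square. f p = 0)) \<and>
     (\<forall>f\<in>bounded_measurable. \<forall>c. N (\<lambda>p. c * f p) = \<bar>c\<bar> * N f) \<and>
     (\<forall>f\<in>bounded_measurable. \<forall>g\<in>bounded_measurable. N (\<lambda>p. f p + g p) \<le> N f + N g)"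

text \<open>The orientation cannot be arbitrary: if it contains a directed path $u \to v \to w$, then
  the indicator function of $[0, 1/2) \times [1/2, 1]$ gets the value zero. So a suitable
  orientation directs every edge from one class of a bipartition to the other, which is the usual
  convention for functions that need not be symmetric. For symmetric functions the choice does not
  matter, by the lemma below.\<close>

definition weakly_norming :: "'a set \<Rightarrow> 'a set set \<Rightarrow> bool" where
  "weakly_norming V E \<longleftrightarrow>
     (\<exists>D. orientation E D \<and> is_norm_on_bounded_measurable (r_norm V E D))"

lemma r_norm_symmetric:
  assumes "orientation E D" and "orientation E D'" and sym: "\<And>s t. f (s, t) = f (t, s)"
  shows "r_norm V E D f = r_norm V E D' f"
proof -
  have "(\<Prod>(i, j)\<in>A. \<bar>f (x i, x j)\<bar>) =
        (\<Prod>e\<in>E. \<bar>f (SOME p. \<exists>u v. e = {u, v} \<and> p = (x u, x v))\<bar>)"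
    if A: "orientation E A" for A and x :: "'a \<Rightarrow> real"
  proof -
    have some: "f (SOME p. \<exists>u' v'. {u, v} = {u', v'} \<and> p = (x u', x v')) = f (x u, x v)" for u v
    proof -
      let ?P = "\<lambda>p. \<exists>u' v'. {u, v} = {u', v'} \<and> p = (x u', x v')"
      have "?P (SOME p. ?P p)"
        by (rule someI[of ?P "(x u, x v)"]) blast
      then obtain u' v' where "{u, v} = {u', v'}" and eq: "(SOME p. ?P p) = (x u', x v')"
        by blast
      then have "(u' = u \<and> v' = v) \<or> (u' = v \<and> v' = u)"
        by (auto simp: doubleton_eq_iff)
      with sym show ?thesis
        unfolding eq by auto
    qed
    have "(\<Prod>(i, j)\<in>A. \<bar>f (x i, x j)\<bar>) =
      (\<Prod>a\<in>A. \<bar>f (SOME p. \<exists>u v. (\<lambda>(u, v). {u, v}) a = {u, v} \<and> p = (x u, x v))\<bar>)"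
      by (rule prod.cong) (auto simp: some)
    then show ?thesis
      using prod.reindex_bij_betw[OF A[unfolded orientation_def],
        of "\<lambda>e. \<bar>f (SOME p. \<exists>u v. e = {u, v} \<and> p = (x u, x v))\<bar>"] by simp
  qed
  with assms show ?thesis
    by (simp add: r_norm_def)
qed

end

theory Submission
  imports Defs "HOL-Probability.Infinite_Product_Measure"
begin

text \<open>Folding along a cut involution is an instance of the Cauchy--Schwarz inequality: if \<open>I(f)\<close> is
  the integral of $\prod_e f_e(x_i, x_j)$ for a family \<open>f\<close> of nonnegative functions indexed by the
  edges, then $I(f)^2 \le I(f \circ \phi^+) \, I(f \circ \phi^-)$. Hence, among the finitely many
  families $f \circ \psi$ with $\psi : E \to E$, a family with the largest integral remains one under
  all foldings. The monochromatic leaf gives a composition of foldings that collapses \<open>E\<close> to a single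
  edge, so the largest integral is attained by a constant family. This is the Hoelder inequality
  $I(f) \le \prod_e \|f_e\|$, from which the triangle inequality and definiteness follow.

  The same composition of foldings is a homomorphism to a single edge, so the graph is bipartite,
  and the edges are oriented along the bipartition.\<close>

section \<open>Cauchy--Schwarz inequality for a reflection\<close>

text \<open>Multiplying the inequalities along the whole tree would leave 2^d leaf integrals, of
  which only one is known to belong to a constant family. Starting from a maximal family avoids
  this: at every folding the unwanted factor is at most the maximum \<open>m\<close>, so
  \<open>m\<^sup>2 \<le> m * J\<close> for the integral \<open>J\<close> of the family on the chosen
  branch, and only one path has to be followed. Cancelling \<open>m\<close> requires it to be
  finite, which is where boundedness of the functions enters.

  Different functions on different edges are unavoidable, because expanding the product for
  \<open>f + g\<close> assigns \<open>f\<close> to some edges and \<open>g\<close> to the others.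

  Since the functions need not be symmetric, a folding must also respect the direction of edges. It
  does, because a cut involution of a connected graph fixes a vertex and so keeps each class of the
  bipartition.

  All inequalities are proved for extended nonnegative Borel functions on an uncompleted product,
  where Fubini needs no integrability. Lebesgue measurable functions enter only through almost
  everywhere equal Borel representatives.\<close>

definition edge_integral ::
    "'b measure \<Rightarrow> 'a set \<Rightarrow> ('a \<times> 'a) set \<Rightarrow> ('a \<times> 'a \<Rightarrow> 'b \<times> 'b \<Rightarrow> ennreal) \<Rightarrow> ennreal" where
  "edge_integral M V D f =
     (\<integral>\<^sup>+ x. (\<Prod>e\<in>D. f e (x (fst e), x (snd e))) \<partial>PiM V (\<lambda>_. M))"

lemma measurable_edge_prod:
  fixes f :: "'a \<times> 'a \<Rightarrow> 'b \<times> 'b \<Rightarrow> ennreal"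
  assumes "D \<subseteq> V \<times> V" and "\<And>e. e \<in> D \<Longrightarrow> f e \<in> borel_measurable (M \<Otimes>\<^sub>M M)"
  shows "(\<lambda>x. \<Prod>e\<in>D. f e (x (fst e), x (snd e))) \<in> borel_measurable (PiM V (\<lambda>_. M))"
proof (rule borel_measurable_prod_ennreal)
  fix e assume e: "e \<in> D"
  with assms(1) have "fst e \<in> V" "snd e \<in> V" by auto
  then have "(\<lambda>x. (x (fst e), x (snd e))) \<in> PiM V (\<lambda>_. M) \<rightarrow>\<^sub>M M \<Otimes>\<^sub>M M"
    by measurable
  from measurable_compose[OF this assms(2)[OF e]]
  show "(\<lambda>x. f e (x (fst e), x (snd e))) \<in> borel_measurable (PiM V (\<lambda>_. M))" .
qed

text \<open>No edge joins \<open>L\<close> to \<open>R\<close>, so once the coordinates in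
  \<open>F\<close> are fixed, the product over the edges splits into a function of the
  \<open>L\<close>-coordinates and one of the \<open>R\<close>-coordinates. Invariance of
  \<open>D\<close> lets the reflection match the edges at \<open>R\<close> with those at
  \<open>L\<close>.\<close>

locale edge_reflection = prob_space M
  for M :: "'b measure" +
  fixes F L R :: "'a set" and D :: "('a \<times> 'a) set" and \<phi> :: "'a \<Rightarrow> 'a"
  assumes fin: "finite F" "finite L" "finite R"
    and disj: "F \<inter> L = {}" "F \<inter> R = {}" "L \<inter> R = {}"
    and fixed: "\<And>v. v \<in> F \<Longrightarrow> \<phi> v = v"
    and swap: "\<phi> ` L = R" "\<phi> ` R = L"
    and invol: "\<And>v. v \<in> L \<union> R \<Longrightarrow> \<phi> (\<phi> v) = v"
    and edges: "D \<subseteq> (F \<union> L) \<times> (F \<union> L) \<union> (F \<union> R) \<times> (F \<union> R)"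
    and edges_invariant: "map_prod \<phi> \<phi> ` D \<subseteq> D"
begin

lemma swapped: "edge_reflection M F R L D \<phi>"
  using fin disj fixed swap invol edges edges_invariant
  by unfold_locales auto

definition incident :: "'a set \<Rightarrow> ('a \<times> 'a) set" where
  "incident K = {e \<in> D. fst e \<in> K \<or> snd e \<in> K}"

text \<open>For \<open>K = L\<close> or \<open>K = R\<close> this is the conditional expectation,
  given the coordinates \<open>x\<close> in \<open>F\<close>, of the part of the product that
  involves \<open>K\<close>.\<close>

definition partial_integral :: "'a set \<Rightarrow> ('a \<times> 'a \<Rightarrow> 'b \<times> 'b \<Rightarrow> ennreal) \<Rightarrow> ('a \<Rightarrow> 'b) \<Rightarrow> ennreal" where
  "partial_integral K f x =
     (\<integral>\<^sup>+ y. (\<Prod>e\<in>incident K. f e (merge F K (x, y) (fst e), merge F K (x, y) (snd e)))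
       \<partial>PiM K (\<lambda>_. M))"

lemma finite_D: "finite D"
  using edges fin by (meson finite_SigmaI finite_Un finite_subset)

lemma edge_cases:
  assumes "(a, b) \<in> D"
  shows "(a \<in> F \<union> L \<and> b \<in> F \<union> L) \<or> (a \<in> F \<union> R \<and> b \<in> F \<union> R)"
  using assms edges by blast

lemma incident_subset: "incident L \<subseteq> (F \<union> L) \<times> (F \<union> L)" "incident R \<subseteq> (F \<union> R) \<times> (F \<union> R)"
  using disj by (auto simp: incident_def dest!: edge_cases)

lemma D_split:
  "D = (D \<inter> F \<times> F) \<union> incident L \<union> incident R"
  "(D \<inter> F \<times> F) \<inter> incident L = {}" "((D \<inter> F \<times> F) \<union> incident L) \<inter> incident R = {}"
proof -
  show "D = (D \<inter> F \<times> F) \<union> incident L \<union> incident R"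
    using edge_cases by (force simp: incident_def)
  show "(D \<inter> F \<times> F) \<inter> incident L = {}"
    using disj by (auto simp: incident_def)
  have "a \<notin> R \<and> b \<notin> R" if "(a, b) \<in> (D \<inter> F \<times> F) \<union> incident L" for a b
    using that disj incident_subset(1) by blast
  then show "((D \<inter> F \<times> F) \<union> incident L) \<inter> incident R = {}"
    by (fastforce simp: incident_def)
qed

lemma measurable_incident_prod:
  assumes "incident K \<subseteq> (F \<union> K) \<times> (F \<union> K)"
    and "\<And>e. e \<in> D \<Longrightarrow> f e \<in> borel_measurable (M \<Otimes>\<^sub>M M)"
  shows "(\<lambda>z. \<Prod>e\<in>incident K. f e (z (fst e), z (snd e)) :: ennreal)
    \<in> borel_measurable (PiM (F \<union> K) (\<lambda>_. M))"
  by (rule measurable_edge_prod[OF assms(1)]) (auto intro: assms(2) simp: incident_def)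

lemma measurable_partial_integral:
  assumes K: "finite K" "incident K \<subseteq> (F \<union> K) \<times> (F \<union> K)"
    and f: "\<And>e. e \<in> D \<Longrightarrow> f e \<in> borel_measurable (M \<Otimes>\<^sub>M M)"
  shows "partial_integral K f \<in> borel_measurable (PiM F (\<lambda>_. M))"
proof -
  interpret product_sigma_finite "\<lambda>_::'a. M" ..
  interpret K: finite_product_sigma_finite "\<lambda>_::'a. M" K by unfold_locales (rule K)
  have "(\<lambda>p. \<Prod>e\<in>incident K. f e (merge F K p (fst e), merge F K p (snd e)))
    \<in> borel_measurable (PiM F (\<lambda>_. M) \<Otimes>\<^sub>M PiM K (\<lambda>_. M))"
    by (rule measurable_compose[OF measurable_merge measurable_incident_prod[OF K(2) f]])
  then show ?thesis
    unfolding partial_integral_def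
    by (intro K.borel_measurable_nn_integral) (simp add: case_prod_beta')
qed

text \<open>Fubini twice: the coordinates in \<open>R\<close> are integrated out before those in
  \<open>L\<close>, and each time the factors that do not see the current coordinates are pulled
  out.\<close>

lemma edge_integral_fold:
  assumes f: "\<And>e. e \<in> D \<Longrightarrow> f e \<in> borel_measurable (M \<Otimes>\<^sub>M M)"
  shows "edge_integral M (F \<union> L \<union> R) D f =
    (\<integral>\<^sup>+ x. (\<Prod>e\<in>D \<inter> F \<times> F. f e (x (fst e), x (snd e))) *
       (partial_integral L f x * partial_integral R f x) \<partial>PiM F (\<lambda>_. M))"
proof -
  interpret product_sigma_finite "\<lambda>_::'a. M" ..
  let ?P = "\<lambda>S z. \<Prod>e\<in>S. f e (z (fst e), z (snd e))"
  let ?W = "D \<inter> F \<times> F"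
  have mP: "?P S \<in> borel_measurable (PiM K (\<lambda>_. M))" if "S \<subseteq> K \<times> K" "S \<subseteq> D" for S K
    by (rule measurable_edge_prod[OF that(1)]) (use that f in auto)
  have cong: "?P S z = ?P S z'" if "S \<subseteq> K \<times> K" "\<And>v. v \<in> K \<Longrightarrow> z v = z' v" for S K z z'
    using that by (intro prod.cong refl) (auto simp: subset_iff)
  have D: "D \<subseteq> (F \<union> L \<union> R) \<times> (F \<union> L \<union> R)" using edges by auto
  have inD: "incident L \<subseteq> D" "incident R \<subseteq> D" by (auto simp: incident_def)
  have P_split: "?P D z = ?P (?W \<union> incident L) z * ?P (incident R) z" for z
    apply (subst D_split(1))
    apply (subst prod.union_disjoint)
    using D_split finite_D by (auto simp: incident_def)
  have P_split': "?P (?W \<union> incident L) z = ?P ?W z * ?P (incident L) z" for z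
    apply (subst prod.union_disjoint)
    using D_split finite_D by (auto simp: incident_def)
  have mFR: "(\<lambda>y. ?P (incident R) (merge F R (x, y))) \<in> borel_measurable (PiM R (\<lambda>_. M))"
    if "x \<in> space (PiM F (\<lambda>_. M))" for x
    by (rule measurable_compose[OF _ mP[OF incident_subset(2) inD(2)]]) (use that in measurable)
  have mFL: "(\<lambda>y. ?P (incident L) (merge F L (x, y))) \<in> borel_measurable (PiM L (\<lambda>_. M))"
    if "x \<in> space (PiM F (\<lambda>_. M))" for x
    by (rule measurable_compose[OF _ mP[OF incident_subset(1) inD(1)]]) (use that in measurable)
  have pR: "partial_integral R f (restrict z F) = partial_integral R f z" for z
    unfolding partial_integral_def by simp
  have "edge_integral M (F \<union> L \<union> R) D f =
    (\<integral>\<^sup>+ z. (\<integral>\<^sup>+ y. ?P D (merge (F \<union> L) R (z, y)) \<partial>PiM R (\<lambda>_. M)) \<partial>PiM (F \<union> L) (\<lambda>_. M))"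
    unfolding edge_integral_def
    by (rule product_nn_integral_fold) (use fin disj mP[OF D] in auto)
  \<comment> \<open>The points of \<open>PiM F\<close> are undefined outside \<open>F\<close>, and
    measurability of the partial integral is known only on that space. The restriction moves
    \<open>z\<close> there.\<close>
  also have "\<dots> = (\<integral>\<^sup>+ z. ?P (?W \<union> incident L) z * partial_integral R f (restrict z F)
      \<partial>PiM (F \<union> L) (\<lambda>_. M))"
  proof (rule nn_integral_cong)
    fix z assume z: "z \<in> space (PiM (F \<union> L) (\<lambda>_. M))"
    then have zF: "restrict z F \<in> space (PiM F (\<lambda>_. M))"
      by (auto simp: space_PiM)
    have "?P D (merge (F \<union> L) R (z, y)) =
        ?P (?W \<union> incident L) z * ?P (incident R) (merge F R (restrict z F, y))" for y
      unfolding P_split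
      apply (intro arg_cong2[where f = "(*)"])
       apply (rule cong[of _ "F \<union> L"])
      using incident_subset apply blast
       apply (simp add: merge_def)
      apply (rule cong[OF incident_subset(2)])
      using disj apply (auto simp: merge_def)
      done
    then show "(\<integral>\<^sup>+ y. ?P D (merge (F \<union> L) R (z, y)) \<partial>PiM R (\<lambda>_. M)) =
        ?P (?W \<union> incident L) z * partial_integral R f (restrict z F)"
      unfolding partial_integral_def using mFR[OF zF] by (simp only: nn_integral_cmult)
  qed
  also have "\<dots> = (\<integral>\<^sup>+ x. (\<integral>\<^sup>+ y. ?P (?W \<union> incident L) (merge F L (x, y)) *
      partial_integral R f (restrict (merge F L (x, y)) F) \<partial>PiM L (\<lambda>_. M)) \<partial>PiM F (\<lambda>_. M))"
  proof (rule product_nn_integral_fold)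
    have "(\<lambda>z. partial_integral R f (restrict z F)) \<in> borel_measurable (PiM (F \<union> L) (\<lambda>_. M))"
      by (rule measurable_compose[OF _ measurable_partial_integral[OF fin(3) incident_subset(2) f]])
        (auto intro: measurable_restrict_subset)
    moreover have "?P (?W \<union> incident L) \<in> borel_measurable (PiM (F \<union> L) (\<lambda>_. M))"
      by (rule mP) (use incident_subset inD in auto)
    ultimately show "(\<lambda>z. ?P (?W \<union> incident L) z * partial_integral R f (restrict z F))
        \<in> borel_measurable (PiM (F \<union> L) (\<lambda>_. M))"
      by (rule borel_measurable_times_ennreal[rotated])
  qed (use disj fin in auto)
  also have "\<dots> = (\<integral>\<^sup>+ x. ?P ?W x * (partial_integral L f x * partial_integral R f x) \<partial>PiM F (\<lambda>_. M))"
  proof (rule nn_integral_cong)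
    fix x assume x: "x \<in> space (PiM F (\<lambda>_. M))"
    have r: "restrict (merge F L (x, y)) F = x" for y
      using x disj by (auto simp: space_PiM PiE_def extensional_def merge_def fun_eq_iff)
    have "?P ?W (merge F L (x, y)) = ?P ?W x" for y
      by (rule cong[of _ F]) (auto simp: merge_def)
    then have "?P (?W \<union> incident L) (merge F L (x, y)) * partial_integral R f (restrict (merge F L (x, y)) F) =
        (?P ?W x * partial_integral R f x) * ?P (incident L) (merge F L (x, y))" for y
      by (simp only: P_split' r mult_ac)
    then show "(\<integral>\<^sup>+ y. ?P (?W \<union> incident L) (merge F L (x, y)) *
      partial_integral R f (restrict (merge F L (x, y)) F) \<partial>PiM L (\<lambda>_. M)) =
      ?P ?W x * (partial_integral L f x * partial_integral R f x)"
      using mFL[OF x] by (simp only: nn_integral_cmult partial_integral_def[of L]) (simp add: mult_ac)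
  qed
  finally show ?thesis .
qed

text \<open>A change of variables: renaming the coordinates in \<open>R\<close> along \<phi> carries
  the product measure on \<open>R\<close> to that on \<open>L\<close>, while the coordinates in
  \<open>F\<close> stay because \<phi> fixes \<open>F\<close>.\<close>

lemma partial_integral_reflect:
  assumes f: "\<And>e. e \<in> D \<Longrightarrow> f e \<in> borel_measurable (M \<Otimes>\<^sub>M M)"
  assumes x: "x \<in> space (PiM F (\<lambda>_. M))"
  shows "partial_integral R (\<lambda>e. f (map_prod \<phi> \<phi> e)) x = partial_integral L f x"
proof -
  have inj: "inj_on \<phi> L"
    by (rule inj_on_inverseI[of _ \<phi>]) (use invol in auto)
  have im: "map_prod \<phi> \<phi> ` incident R = incident L"
  proof (intro equalityI subsetI)
    fix e assume "e \<in> incident L"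
    moreover from this have "e = map_prod \<phi> \<phi> (map_prod \<phi> \<phi> e)"
      using incident_subset(1) fixed invol by (cases e) auto
    moreover have "map_prod \<phi> \<phi> e \<in> incident R" if "e \<in> incident L"
      using that edges_invariant swap by (auto simp: incident_def)
    ultimately show "e \<in> map_prod \<phi> \<phi> ` incident R" by blast
  next
    fix e assume "e \<in> map_prod \<phi> \<phi> ` incident R"
    then show "e \<in> incident L"
      using edges_invariant swap by (auto simp: incident_def)
  qed
  have inj': "inj_on (map_prod \<phi> \<phi>) (incident R)"
  proof (rule inj_on_inverseI[of _ "map_prod \<phi> \<phi>"])
    fix e assume "e \<in> incident R"
    then have "fst e \<in> F \<union> R" "snd e \<in> F \<union> R"
      using incident_subset(2) by auto
    then show "map_prod \<phi> \<phi> (map_prod \<phi> \<phi> e) = e"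
      using fixed invol by (cases e) auto
  qed
  have "PiM L (\<lambda>_. M) = distr (PiM R (\<lambda>_. M)) (PiM L (\<lambda>_. M)) (\<lambda>\<omega>. \<lambda>n\<in>L. \<omega> (\<phi> n))"
    using distr_PiM_reindex[of R "\<lambda>_. M" \<phi> L] inj swap prob_space_axioms by auto
  then have "partial_integral L f x = (\<integral>\<^sup>+ y.
      (\<Prod>e\<in>incident L. f e (merge F L (x, y) (fst e), merge F L (x, y) (snd e)))
       \<partial>distr (PiM R (\<lambda>_. M)) (PiM L (\<lambda>_. M)) (\<lambda>\<omega>. \<lambda>n\<in>L. \<omega> (\<phi> n)))"
    unfolding partial_integral_def by simp
  also have "\<dots> = (\<integral>\<^sup>+ \<omega>.
      (\<Prod>e\<in>incident L. f e (merge F L (x, \<lambda>n\<in>L. \<omega> (\<phi> n)) (fst e), merge F L (x, \<lambda>n\<in>L. \<omega> (\<phi> n)) (snd e)))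
       \<partial>PiM R (\<lambda>_. M))"
  proof (rule nn_integral_distr)
    show "(\<lambda>\<omega>. \<lambda>n\<in>L. \<omega> (\<phi> n)) \<in> PiM R (\<lambda>_. M) \<rightarrow>\<^sub>M PiM L (\<lambda>_. M)"
      using swap by (intro measurable_restrict measurable_component_singleton) auto
    show "(\<lambda>y. \<Prod>e\<in>incident L. f e (merge F L (x, y) (fst e), merge F L (x, y) (snd e)))
        \<in> borel_measurable (distr (PiM R (\<lambda>_. M)) (PiM L (\<lambda>_. M)) (\<lambda>\<omega>. \<lambda>n\<in>L. \<omega> (\<phi> n)))"
      unfolding measurable_distr_eq1
      by (rule measurable_compose[OF _ measurable_incident_prod[OF incident_subset(1) f]])
        (use x in measurable)
  qed
  also have "\<dots> = partial_integral R (\<lambda>e. f (map_prod \<phi> \<phi> e)) x"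
    unfolding partial_integral_def
  proof (rule nn_integral_cong)
    fix \<omega>
    let ?z = "merge F L (x, \<lambda>n\<in>L. \<omega> (\<phi> n))"
    \<comment> \<open>The reflected point read at \<phi> \<open>v\<close> is the original point read
      at \<open>v\<close>; this turns the factors of the edges at \<open>L\<close> into those of the
      edges at \<open>R\<close>.\<close>
    have z: "?z (\<phi> v) = merge F R (x, \<omega>) v" if "v \<in> F \<union> R" for v
      using that disj swap fixed invol by (auto simp: merge_def)
    have "(\<Prod>e\<in>incident L. f e (?z (fst e), ?z (snd e))) =
        (\<Prod>e\<in>incident R. f (map_prod \<phi> \<phi> e) (?z (\<phi> (fst e)), ?z (\<phi> (snd e))))"
      unfolding im[symmetric] by (subst prod.reindex[OF inj']) simp
    also have "\<dots> = (\<Prod>e\<in>incident R. f (map_prod \<phi> \<phi> e) (merge F R (x, \<omega>) (fst e), merge F R (x, \<omega>) (snd e)))"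
      by (rule prod.cong) (use incident_subset(2) z in \<open>auto simp: subset_iff\<close>)
    finally show "(\<Prod>e\<in>incident L. f e (?z (fst e), ?z (snd e))) = \<dots>" .
  qed
  finally show ?thesis ..
qed

text \<open>Folding keeps the functions on all edges within \<open>F \<union> L\<close> and copies
  those at \<open>L\<close> to their mirror images at \<open>R\<close>. The two conditional factors
  then coincide, which produces the square.\<close>

lemma edge_integral_fold_away:
  assumes f: "\<And>e. e \<in> D \<Longrightarrow> f e \<in> borel_measurable (M \<Otimes>\<^sub>M M)"
  shows "edge_integral M (F \<union> L \<union> R) D (\<lambda>e. f (map_prod (fold_away \<phi> R) (fold_away \<phi> R) e)) =
    (\<integral>\<^sup>+ x. (\<Prod>e\<in>D \<inter> F \<times> F. f e (x (fst e), x (snd e))) * (partial_integral L f x)\<^sup>2 \<partial>PiM F (\<lambda>_. M))"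
proof -
  let ?p = "fold_away \<phi> R"
  let ?f = "\<lambda>e. f (map_prod ?p ?p e)"
  have pF: "?p v = v" if "v \<in> F \<union> L" for v
    using that disj by (auto simp: fold_away_def)
  have pR: "?p v = \<phi> v" if "v \<in> F \<union> R" for v
    using that disj fixed by (auto simp: fold_away_def)
  have eL: "?f e = f e" if "e \<in> incident L" for e
    using that incident_subset(1) pF by (cases e) auto
  have eF: "?f e = f e" if "e \<in> D \<inter> F \<times> F" for e
    using that pF by (cases e) auto
  have eR: "?f e = f (map_prod \<phi> \<phi> e)" if "e \<in> incident R" for e
    using that incident_subset(2) pR by (cases e) auto
  have pD: "map_prod ?p ?p e \<in> D" if "e \<in> D" for e
  proof (cases "e \<in> incident R")
    case True
    then show ?thesis
      using incident_subset(2) pR edges_invariant that by (cases e) force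
  next
    case False
    then have "map_prod ?p ?p e = e"
      using D_split(1) incident_subset(1) pF that by (cases e) auto
    with that show ?thesis by simp
  qed
  have mf: "?f e \<in> borel_measurable (M \<Otimes>\<^sub>M M)" if "e \<in> D" for e
    by (rule f[OF pD[OF that]])
  show ?thesis
  proof (subst edge_integral_fold[where f = ?f])
    show "?f e \<in> borel_measurable (M \<Otimes>\<^sub>M M)" if "e \<in> D" for e
      by (rule mf[OF that])
  next
    show "(\<integral>\<^sup>+ x. (\<Prod>e\<in>D \<inter> F \<times> F. ?f e (x (fst e), x (snd e))) *
       (partial_integral L ?f x * partial_integral R ?f x) \<partial>PiM F (\<lambda>_. M)) =
      (\<integral>\<^sup>+ x. (\<Prod>e\<in>D \<inter> F \<times> F. f e (x (fst e), x (snd e))) * (partial_integral L f x)\<^sup>2 \<partial>PiM F (\<lambda>_. M))"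
    proof (rule nn_integral_cong)
      fix x assume x: "x \<in> space (PiM F (\<lambda>_. M))"
      have "partial_integral L ?f x = partial_integral L f x"
        unfolding partial_integral_def by (intro nn_integral_cong prod.cong) (simp_all only: eL)
      moreover have "partial_integral R ?f x = partial_integral R (\<lambda>e. f (map_prod \<phi> \<phi> e)) x"
        unfolding partial_integral_def by (intro nn_integral_cong prod.cong) (simp_all only: eR)
      moreover have "(\<Prod>e\<in>D \<inter> F \<times> F. ?f e (x (fst e), x (snd e))) = (\<Prod>e\<in>D \<inter> F \<times> F. f e (x (fst e), x (snd e)))"
        by (intro prod.cong) (simp_all only: eF)
      ultimately show "(\<Prod>e\<in>D \<inter> F \<times> F. ?f e (x (fst e), x (snd e))) * (partial_integral L ?f x * partial_integral R ?f x) =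
        (\<Prod>e\<in>D \<inter> F \<times> F. f e (x (fst e), x (snd e))) * (partial_integral L f x)\<^sup>2"
        using partial_integral_reflect[of f, OF f x] by (simp add: power2_eq_square)
    qed
  qed
qed

lemma edge_integral_Cauchy_Schwarz:
  assumes f: "\<And>e. e \<in> D \<Longrightarrow> f e \<in> borel_measurable (M \<Otimes>\<^sub>M M)"
  shows "(edge_integral M (F \<union> L \<union> R) D f)\<^sup>2 \<le>
    edge_integral M (F \<union> L \<union> R) D (\<lambda>e. f (map_prod (fold_away \<phi> R) (fold_away \<phi> R) e)) *
    edge_integral M (F \<union> L \<union> R) D (\<lambda>e. f (map_prod (fold_away \<phi> L) (fold_away \<phi> L) e))"
proof -
  interpret S: edge_reflection M F R L D \<phi> by (rule swapped)
  let ?W = "\<lambda>x. \<Prod>e\<in>D \<inter> F \<times> F. f e (x (fst e), x (snd e))"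
  \<comment> \<open>The edges inside \<open>F\<close> become a weight of the measure, so the
    ordinary Cauchy-Schwarz inequality for the two partial integrals already has the weight once in
    each factor.\<close>
  let ?N = "density (PiM F (\<lambda>_. M)) ?W"
  have mW [measurable]: "?W \<in> borel_measurable (PiM F (\<lambda>_. M))"
    by (rule measurable_edge_prod) (use f in auto)
  have mL [measurable]: "partial_integral L f \<in> borel_measurable (PiM F (\<lambda>_. M))"
    by (rule measurable_partial_integral[OF fin(2) incident_subset(1) f])
  have mR [measurable]: "partial_integral R f \<in> borel_measurable (PiM F (\<lambda>_. M))"
    by (rule measurable_partial_integral[OF fin(3) incident_subset(2) f])
  have eq: "F \<union> L \<union> R = F \<union> R \<union> L" by auto
  have "edge_integral M (F \<union> L \<union> R) D f =
      (\<integral>\<^sup>+ x. partial_integral L f x * partial_integral R f x \<partial>?N)"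
    by (subst edge_integral_fold[of f, OF f]) (simp_all add: nn_integral_density)
  moreover have "edge_integral M (F \<union> L \<union> R) D (\<lambda>e. f (map_prod (fold_away \<phi> R) (fold_away \<phi> R) e)) =
      (\<integral>\<^sup>+ x. (partial_integral L f x)\<^sup>2 \<partial>?N)"
    by (subst edge_integral_fold_away[of f, OF f]) (simp_all add: nn_integral_density)
  moreover have "edge_integral M (F \<union> L \<union> R) D (\<lambda>e. f (map_prod (fold_away \<phi> L) (fold_away \<phi> L) e)) =
      (\<integral>\<^sup>+ x. (partial_integral R f x)\<^sup>2 \<partial>?N)"
    using S.edge_integral_fold_away[of f, OF f]
    by (simp only: eq nn_integral_density[OF mW borel_measurable_power_ennreal[OF mR]])
  ultimately show ?thesis
    using Cauchy_Schwarz_nn_integral[of "partial_integral L f" ?N "partial_integral R f"] by simp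
qed

end

section \<open>Hoelder inequality for collapsible edge sets\<close>

text \<open>The roles are asymmetric: \<open>p\<close> is the folding on the chosen branch, while of
  its companion \<open>q\<close> it matters only that it maps \<open>D\<close> to itself, so that
  the second integral competes for the maximum.\<close>

definition Cauchy_Schwarz_map ::
    "'b measure \<Rightarrow> 'a set \<Rightarrow> ('a \<times> 'a) set \<Rightarrow> ('a \<Rightarrow> 'a) \<Rightarrow> bool" where
  "Cauchy_Schwarz_map M V D p \<longleftrightarrow> map_prod p p \<in> D \<rightarrow> D \<and>
     (\<exists>q. map_prod q q \<in> D \<rightarrow> D \<and>
       (\<forall>f. (\<forall>e\<in>D. f e \<in> borel_measurable (M \<Otimes>\<^sub>M M)) \<longrightarrow>
         (edge_integral M V D f)\<^sup>2 \<le>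
           edge_integral M V D (\<lambda>e. f (map_prod p p e)) *
           edge_integral M V D (\<lambda>e. f (map_prod q q e))))"

lemma edge_integral_cong:
  assumes "\<And>e. e \<in> D \<Longrightarrow> f e = g e"
  shows "edge_integral M V D f = edge_integral M V D g"
  unfolding edge_integral_def using assms by (intro nn_integral_cong prod.cong) auto

context prob_space
begin

lemma edge_integral_le_power:
  assumes "\<And>e p. e \<in> D \<Longrightarrow> f e p \<le> B"
  shows "edge_integral M V D f \<le> B ^ card D"
proof -
  interpret P: prob_space "PiM V (\<lambda>_. M)"
    by (rule prob_space_PiM) (rule prob_space_axioms)
  have "edge_integral M V D f \<le> (\<integral>\<^sup>+ x. B ^ card D \<partial>PiM V (\<lambda>_. M))"
    unfolding edge_integral_def prod_constant[symmetric]
    using assms by (intro nn_integral_mono prod_mono_ennreal) auto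
  then show ?thesis
    by (simp add: P.emeasure_space_1)
qed

text \<open>The Hoelder inequality in normalised form; homogeneity supplies the scaling where it is
  used.\<close>

lemma edge_integral_le_one:
  assumes fin: "finite D"
    and cs: "\<And>p. p \<in> set ps \<Longrightarrow> Cauchy_Schwarz_map M V D p"
    and collapse: "\<And>e. e \<in> D \<Longrightarrow> map_prod (foldr (\<circ>) ps id) (foldr (\<circ>) ps id) e = e0" and e0: "e0 \<in> D"
    and meas: "\<And>e. e \<in> D \<Longrightarrow> f e \<in> borel_measurable (M \<Otimes>\<^sub>M M)"
    and bounded: "\<And>e p. e \<in> D \<Longrightarrow> f e p \<le> B" "B < \<infinity>"
    and le_one: "\<And>e. e \<in> D \<Longrightarrow> edge_integral M V D (\<lambda>_. f e) \<le> 1"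
  shows "edge_integral M V D f \<le> 1"
proof -
  define I where "I \<psi> = edge_integral M V D (\<lambda>e. f (\<psi> e))" for \<psi>
  \<comment> \<open>Extensional functions leave only finitely many families, so the maximum
    exists.\<close>
  define m where "m = Max (I ` (D \<rightarrow>\<^sub>E D))"
  have finI: "finite (I ` (D \<rightarrow>\<^sub>E D))"
    using fin by (intro finite_imageI finite_PiE) auto
  have I_cong: "I \<psi> = I \<psi>'" if "\<And>e. e \<in> D \<Longrightarrow> \<psi> e = \<psi>' e" for \<psi> \<psi>'
    unfolding I_def by (rule edge_integral_cong) (simp add: that)
  have le_m: "I \<psi> \<le> m" if "\<psi> \<in> D \<rightarrow> D" for \<psi>
  proof -
    have "I \<psi> = I (restrict \<psi> D)"
      by (rule I_cong) simp
    also have "\<dots> \<le> m"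
      unfolding m_def using that by (intro Max_ge finI imageI) auto
    finally show ?thesis .
  qed
  have "restrict id D \<in> D \<rightarrow>\<^sub>E D"
    by auto
  then have "m \<in> I ` (D \<rightarrow>\<^sub>E D)"
    unfolding m_def by (intro Max_in finI) blast
  then obtain \<psi> where \<psi>: "\<psi> \<in> D \<rightarrow> D" "I \<psi> = m"
    by (auto simp: PiE_iff)
  have "I \<psi> \<le> B ^ card D"
    unfolding I_def using \<psi>(1) by (intro edge_integral_le_power bounded(1)) auto
  also have "\<dots> < \<infinity>"
    using bounded(2) by (simp add: power_less_top_ennreal)
  finally have m_fin: "m < \<infinity>"
    using \<psi>(2) by simp
  have "m \<le> 1"
  proof (cases "m = 0")
    case False
    \<comment> \<open>Maximality is carried along the list for an arbitrary starting \<psi>: the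
      head \<open>p\<close> is the outermost factor of the composition, so it is absorbed into
      \<psi> before the induction continues with \<open>qs\<close>.\<close>
    have "\<psi> \<circ> map_prod (foldr (\<circ>) qs id) (foldr (\<circ>) qs id) \<in> D \<rightarrow> D \<and>
        I (\<psi> \<circ> map_prod (foldr (\<circ>) qs id) (foldr (\<circ>) qs id)) = m"
      if "set qs \<subseteq> set ps" "\<psi> \<in> D \<rightarrow> D" "I \<psi> = m" for qs \<psi>
      using that
    proof (induction qs arbitrary: \<psi>)
      case Nil
      then show ?case by (simp add: map_prod.id)
    next
      case (Cons p qs)
      then have "Cauchy_Schwarz_map M V D p"
        using cs by auto
      then obtain q where p: "map_prod p p \<in> D \<rightarrow> D" and q: "map_prod q q \<in> D \<rightarrow> D"
        and le: "\<And>f. (\<forall>e\<in>D. f e \<in> borel_measurable (M \<Otimes>\<^sub>M M)) \<Longrightarrow>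
         (edge_integral M V D f)\<^sup>2 \<le>
           edge_integral M V D (\<lambda>e. f (map_prod p p e)) *
           edge_integral M V D (\<lambda>e. f (map_prod q q e))"
        unfolding Cauchy_Schwarz_map_def by blast
      have pD: "\<psi> \<circ> map_prod p p \<in> D \<rightarrow> D" and qD: "\<psi> \<circ> map_prod q q \<in> D \<rightarrow> D"
        using Cons.prems(2) p q by (auto simp: Pi_iff)
      \<comment> \<open>The inequality is applied to the rearranged family
        \<open>f \<circ> \<psi>\<close>, whose integral is \<open>m\<close>.\<close>
      have "m * m \<le> I (\<psi> \<circ> map_prod p p) * I (\<psi> \<circ> map_prod q q)"
        using le[of "\<lambda>e. f (\<psi> e)"] meas Cons.prems(2,3)
        by (auto simp: I_def power2_eq_square Pi_iff)
      also have "\<dots> \<le> I (\<psi> \<circ> map_prod p p) * m"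
        by (intro mult_left_mono le_m qD) simp
      also have "\<dots> = m * I (\<psi> \<circ> map_prod p p)"
        by (rule mult.commute)
      finally have "m \<le> I (\<psi> \<circ> map_prod p p)"
        using False m_fin by (simp add: ennreal_mult_le_mult_iff)
      then have "I (\<psi> \<circ> map_prod p p) = m"
        using le_m[OF pD] by simp
      have "set qs \<subseteq> set ps"
        using Cons.prems(1) by simp
      note IH = Cons.IH[OF this pD \<open>I (\<psi> \<circ> map_prod p p) = m\<close>]
      have "\<psi> \<circ> map_prod (foldr (\<circ>) (p # qs) id) (foldr (\<circ>) (p # qs) id) =
          \<psi> \<circ> map_prod p p \<circ> map_prod (foldr (\<circ>) qs id) (foldr (\<circ>) qs id)"
        by (auto simp: fun_eq_iff)
      with IH show ?case
        by (simp only:)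
    qed
    from this[of ps, OF subset_refl \<psi>]
    have "m = I (\<psi> \<circ> map_prod (foldr (\<circ>) ps id) (foldr (\<circ>) ps id))"
      by simp
    \<comment> \<open>After the collapse every edge carries the single function
      \<open>f (\<psi> e0)\<close>, so the normalisation hypothesis applies.\<close>
    also have "\<dots> = I (\<lambda>_. \<psi> e0)"
      by (rule I_cong) (simp add: collapse)
    also have "\<dots> \<le> 1"
      unfolding I_def using \<psi>(1) e0 by (intro le_one) auto
    finally show ?thesis .
  qed simp
  moreover have "edge_integral M V D f = I id"
    by (simp add: I_def)
  ultimately show ?thesis
    using le_m[of id] by (auto intro: order_trans)
qed

section \<open>Homogeneity, mixed expansions and two-coordinate marginals\<close>

lemma edge_integral_cmult:
  assumes D: "D \<subseteq> V \<times> V" and f: "\<And>e. e \<in> D \<Longrightarrow> f e \<in> borel_measurable (M \<Otimes>\<^sub>M M)"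
  shows "edge_integral M V D (\<lambda>e p. c e * f e p) = (\<Prod>e\<in>D. c e) * edge_integral M V D f"
  unfolding edge_integral_def prod.distrib
  by (intro nn_integral_cmult measurable_edge_prod D f)

text \<open>The product over the edges expands into a sum over the sets \<open>X\<close> of edges
  that carry \<open>f\<close>. Bounding each mixed integral by 1 leaves the binomial expansion of
  \<open>(a + b) ^ card D\<close>.\<close>

lemma edge_integral_add_le:
  assumes fin: "finite D" and D: "D \<subseteq> V \<times> V"
    and f: "f \<in> borel_measurable (M \<Otimes>\<^sub>M M)" and g: "g \<in> borel_measurable (M \<Otimes>\<^sub>M M)"
    and mixed: "\<And>X. X \<subseteq> D \<Longrightarrow> edge_integral M V D (\<lambda>e. if e \<in> X then f else g) \<le> 1"
  shows "edge_integral M V D (\<lambda>_ p. a * f p + b * g p) \<le> (a + b) ^ card D"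
proof -
  let ?P = "\<lambda>X x. \<Prod>e\<in>D. (if e \<in> X then f else g) (x (fst e), x (snd e))"
  let ?c = "\<lambda>X. (\<Prod>e\<in>X. a) * (\<Prod>e\<in>D - X. b)"
  have m: "?P X \<in> borel_measurable (PiM V (\<lambda>_. M))" for X
    by (rule measurable_edge_prod[OF D]) (use f g in auto)
  have "(\<Prod>e\<in>D. a * f (x (fst e), x (snd e)) + b * g (x (fst e), x (snd e))) =
      (\<Sum>X\<in>Pow D. ?c X * ?P X x)" for x
  proof -
    have "(\<Prod>e\<in>X. a * f (x (fst e), x (snd e))) * (\<Prod>e\<in>D - X. b * g (x (fst e), x (snd e))) =
        ?c X * ?P X x" if "X \<subseteq> D" for X
    proof -
      have "?P X x = (\<Prod>e\<in>X. (if e \<in> X then f else g) (x (fst e), x (snd e))) *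
          (\<Prod>e\<in>D - X. (if e \<in> X then f else g) (x (fst e), x (snd e)))"
        by (subst prod.subset_diff[OF that fin]) (rule mult.commute)
      also have "\<dots> = (\<Prod>e\<in>X. f (x (fst e), x (snd e))) * (\<Prod>e\<in>D - X. g (x (fst e), x (snd e)))"
        by (intro arg_cong2[where f = "(*)"] prod.cong) auto
      finally show ?thesis
        by (simp only: prod.distrib mult_ac)
    qed
    then show ?thesis
      unfolding prod_add[OF fin] by (intro sum.cong) auto
  qed
  then have "edge_integral M V D (\<lambda>_ p. a * f p + b * g p) =
      (\<integral>\<^sup>+ x. (\<Sum>X\<in>Pow D. ?c X * ?P X x) \<partial>PiM V (\<lambda>_. M))"
    unfolding edge_integral_def by simp
  also have "\<dots> = (\<Sum>X\<in>Pow D. (\<integral>\<^sup>+ x. ?c X * ?P X x \<partial>PiM V (\<lambda>_. M)))"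
    by (intro nn_integral_sum borel_measurable_times_ennreal m borel_measurable_const)
  also have "\<dots> = (\<Sum>X\<in>Pow D. ?c X * edge_integral M V D (\<lambda>e. if e \<in> X then f else g))"
    unfolding edge_integral_def by (intro sum.cong nn_integral_cmult m refl)
  also have "\<dots> \<le> (\<Sum>X\<in>Pow D. ?c X * 1)"
    using mixed by (intro sum_mono mult_left_mono) auto
  also have "\<dots> = (a + b) ^ card D"
    using prod_add[OF fin, of "\<lambda>_. a" "\<lambda>_. b"] by simp
  finally show ?thesis .
qed

text \<open>The pair measure is a product indexed by \<open>bool\<close>, and
  \<open>case_bool i j\<close> is an injective reindexing exactly because the two coordinates are
  distinct.\<close>

lemma distr_pair_component:
  assumes "i \<in> V" "j \<in> V" "i \<noteq> j"
  shows "distr (PiM V (\<lambda>_. M)) (M \<Otimes>\<^sub>M M) (\<lambda>x. (x i, x j)) = M \<Otimes>\<^sub>M M"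
proof -
  have eq: "case_bool M M = (\<lambda>_. M)"
    by (auto split: bool.splits)
  have meas: "(\<lambda>x. \<lambda>n\<in>UNIV. x (case_bool i j n)) \<in> PiM V (\<lambda>_. M) \<rightarrow>\<^sub>M PiM UNIV (\<lambda>_::bool. M)"
    using assms by (intro measurable_restrict measurable_component_singleton) (auto split: bool.splits)
  have "distr (PiM V (\<lambda>_. M)) (PiM UNIV (\<lambda>_. M)) (\<lambda>x. \<lambda>n\<in>UNIV. x (case_bool i j n)) =
      PiM UNIV (\<lambda>_. M)"
    using assms prob_space_axioms
    by (intro distr_PiM_reindex) (auto simp: inj_on_def split: bool.splits)
  then have "M \<Otimes>\<^sub>M M = distr (distr (PiM V (\<lambda>_. M)) (PiM UNIV (\<lambda>_. M))
      (\<lambda>x. \<lambda>n\<in>UNIV. x (case_bool i j n))) (M \<Otimes>\<^sub>M M) (\<lambda>x. (x True, x False))"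
    using pair_measure_eq_distr_PiM[OF sigma_finite_measure_axioms sigma_finite_measure_axioms]
    by (simp add: eq)
  also have "\<dots> = distr (PiM V (\<lambda>_. M)) (M \<Otimes>\<^sub>M M) (\<lambda>x. (x i, x j))"
    by (subst distr_distr[OF _ meas]) (auto simp: comp_def)
  finally show ?thesis ..
qed

end

section \<open>Norm properties\<close>

text \<open>Completion makes all subsets of null sets measurable. This is applied to the integrand
  on the cube, which for a Lebesgue measurable function is only almost everywhere equal to a Borel
  one.\<close>

lemma borel_measurable_completion_AE:
  fixes f g :: "'a \<Rightarrow> 'b::topological_space"
  assumes g: "g \<in> borel_measurable M" and ae: "AE x in M. f x = g x"
  shows "f \<in> borel_measurable (completion M)"
proof (rule measurableI)
  fix A :: "'b set" assume A: "A \<in> sets borel"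
  show "f -` A \<inter> space (completion M) \<in> sets (completion M)"
  proof (rule completion.in_sets_AE)
    show "AE x in completion M. x \<in> g -` A \<inter> space M \<longleftrightarrow> x \<in> f -` A \<inter> space (completion M)"
      using AE_completion[OF ae] by eventually_elim auto
    show "g -` A \<inter> space M \<in> sets (completion M)"
      using measurable_sets[OF g A] by auto
  qed auto
qed auto

section \<open>Lebesgue measure on the square and Borel representatives\<close>

abbreviation unit_interval :: "real measure" where
  "unit_interval \<equiv> restrict_space lborel {0..1}"

lemma prob_space_unit_interval: "prob_space unit_interval"
  by (rule prob_space_restrict_space) auto

text \<open>The identity is measurable in both directions, so the sigma-algebras agree, and the
  measures are compared on rectangles.\<close>

lemma pair_unit_interval: "unit_interval \<Otimes>\<^sub>M unit_interval = restrict_space lborel unit_square"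
proof (rule pair_measure_eqI)
  interpret prob_space unit_interval by (rule prob_space_unit_interval)
  show "sigma_finite_measure unit_interval" by (rule sigma_finite_measure_axioms)
  show "sigma_finite_measure unit_interval" by (rule sigma_finite_measure_axioms)
  let ?U = "unit_interval \<Otimes>\<^sub>M unit_interval" and ?S = "restrict_space (lborel :: (real \<times> real) measure) unit_square"
  have sq: "unit_square \<in> sets borel"
    unfolding unit_square_def by (intro borel_closed closed_Times) auto
  have sp: "space ?U = unit_square" "space ?S = unit_square"
    by (auto simp: space_pair_measure space_restrict_space unit_square_def)
  have "(\<lambda>p. (fst p, snd p)) \<in> ?S \<rightarrow>\<^sub>M ?U"
    by (intro measurable_Pair measurable_restrict_space2 measurable_restrict_space1)
      (auto simp: space_restrict_space unit_square_def borel_measurable_continuous_onI continuous_on_fst continuous_on_snd)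
  then have 1: "sets ?U \<subseteq> sets ?S"
    using measurable_sets[of "\<lambda>p. p" ?S ?U] sp sets.sets_into_space[of _ ?U]
    by (auto simp: Int_absorb2)
  have id: "(\<lambda>x. x) \<in> unit_interval \<rightarrow>\<^sub>M borel"
    by (rule measurable_restrict_space1) simp
  have "(\<lambda>p. (fst p, snd p)) \<in> ?U \<rightarrow>\<^sub>M borel \<Otimes>\<^sub>M borel"
    by (intro measurable_Pair measurable_compose[OF measurable_fst id] measurable_compose[OF measurable_snd id])
  then have "(\<lambda>p. p) \<in> ?U \<rightarrow>\<^sub>M ?S"
    by (intro measurable_restrict_space2) (auto simp: sp borel_prod)
  then have 2: "sets ?S \<subseteq> sets ?U"
    using measurable_sets[of "\<lambda>p. p" ?U ?S] sp sets.sets_into_space[of _ ?S]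
    by (auto simp: Int_absorb2)
  from 1 2 show "sets ?U = sets ?S" by blast
  fix A B assume A: "A \<in> sets unit_interval" and B: "B \<in> sets unit_interval"
  have AB: "A \<subseteq> {0..1}" "B \<subseteq> {0..1}" "A \<in> sets borel" "B \<in> sets borel"
    using A B by (auto simp: sets_restrict_space)
  have "emeasure ?S (A \<times> B) = emeasure (lborel \<Otimes>\<^sub>M lborel) (A \<times> B)"
    unfolding lborel_prod using AB sq by (subst emeasure_restrict_space) (auto simp: unit_square_def)
  also have "\<dots> = emeasure lborel A * emeasure lborel B"
    using AB by (intro lborel.emeasure_pair_measure_Times) auto
  also have "\<dots> = emeasure unit_interval A * emeasure unit_interval B"
    using AB by (simp add: emeasure_restrict_space)
  finally show "emeasure unit_interval A * emeasure unit_interval B = emeasure ?S (A \<times> B)" ..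
qed

lemma AE_unit_square:
  "(AE p in lebesgue_on unit_square. P p) \<longleftrightarrow> (AE p in unit_interval \<Otimes>\<^sub>M unit_interval. P p)"
proof -
  have sq: "unit_square \<in> sets borel"
    unfolding unit_square_def by (intro borel_closed closed_Times) auto
  then have "unit_square \<in> sets lebesgue" by auto
  with sq show ?thesis
    unfolding pair_unit_interval by (simp add: AE_restrict_space_iff AE_completion_iff)
qed

lemma bounded_measurable_Borel_version:
  assumes "f \<in> bounded_measurable"
  obtains g B where "g \<in> borel_measurable (unit_interval \<Otimes>\<^sub>M unit_interval)"
    and "\<And>p. 0 \<le> g p" and "\<And>p. g p \<le> (B :: real)"
    and "AE p in lebesgue_on unit_square. \<bar>f p\<bar> = g p"
proof -
  have f: "f \<in> borel_measurable (lebesgue_on unit_square)" and "bounded (f ` unit_square)"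
    using assms by (auto simp: bounded_measurable_def)
  then obtain B where "\<And>p. p \<in> unit_square \<Longrightarrow> \<bar>f p\<bar> \<le> B"
    by (auto simp: bounded_iff)
  then have B: "\<bar>f p\<bar> \<le> \<bar>B\<bar>" if "p \<in> unit_square" for p
    using that by (meson abs_ge_self order_trans)
  have sq: "unit_square \<in> sets borel"
    unfolding unit_square_def by (intro borel_closed closed_Times) auto
  then have sq': "unit_square \<in> sets lebesgue" by auto
  then have "(\<lambda>p. indicator unit_square p *\<^sub>R f p) \<in> borel_measurable lebesgue"
    using f by (subst (asm) borel_measurable_restrict_space_iff) auto
  from completion_ex_borel_measurable_real[OF this]
  obtain g where g: "g \<in> borel_measurable lborel"
    and ae: "AE p in lborel. indicator unit_square p *\<^sub>R f p = g p" by auto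
  show ?thesis
  proof (rule that)
    \<comment> \<open>The Borel representative is bounded only almost everywhere; truncating it
      gives a bound at every point without changing it almost everywhere on the square.\<close>
    show "(\<lambda>p. min \<bar>g p\<bar> \<bar>B\<bar>) \<in> borel_measurable (unit_interval \<Otimes>\<^sub>M unit_interval)"
      unfolding pair_unit_interval by (intro measurable_restrict_space1 borel_measurable_min borel_measurable_abs borel_measurable_const) (use g in simp_all)
    show "AE p in lebesgue_on unit_square. \<bar>f p\<bar> = min \<bar>g p\<bar> \<bar>B\<bar>"
    proof (subst AE_restrict_space_iff)
      show "AE p in lebesgue. p \<in> unit_square \<longrightarrow> \<bar>f p\<bar> = min \<bar>g p\<bar> \<bar>B\<bar>"
        using AE_completion[OF ae]
      proof eventually_elim
        case (elim p)
        then show ?case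
          using B[of p] by auto
      qed
    qed (use sq' in simp)
    show "min \<bar>g p\<bar> \<bar>B\<bar> \<le> \<bar>B\<bar>" for p
      by simp
  qed auto
qed

lemma ennreal_eq_0_if_multiples_bounded:
  fixes r :: ennreal
  assumes le: "\<And>n. of_nat n * r \<le> 1"
  shows "r = 0"
proof (cases r)
  case (real s)
  have "real n * s \<le> 1" for n
    using le[of n] real by (simp add: ennreal_of_nat_eq_real_of_nat ennreal_mult[symmetric])
  then have "\<not> 0 < s"
    using reals_Archimedean3[of s] by (meson not_less)
  with real show ?thesis by simp
next
  case top
  with le[of 1] show ?thesis by (simp add: top_unique)
qed

text \<open>The interface between combinatorics and analysis. Absence of loops ensures that the two
  coordinates of an edge are jointly uniform on the square.\<close>

locale collapsible_edges =
  fixes V :: "'a set" and D :: "('a \<times> 'a) set" and ps :: "('a \<Rightarrow> 'a) list" and e0 :: "'a \<times> 'a"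
  assumes finite_V: "finite V" and edges: "D \<subseteq> V \<times> V" and loopless: "\<And>i j. (i, j) \<in> D \<Longrightarrow> i \<noteq> j"
    and Cauchy_Schwarz: "\<And>p. p \<in> set ps \<Longrightarrow> Cauchy_Schwarz_map unit_interval V D p"
    and collapse: "\<And>e. e \<in> D \<Longrightarrow> map_prod (foldr (\<circ>) ps id) (foldr (\<circ>) ps id) e = e0"
    and e0: "e0 \<in> D"
begin

lemma finite_D: "finite D"
  using edges finite_V by (meson finite_SigmaI finite_subset)

lemma card_pos: "0 < card D"
  using finite_D e0 by (auto simp: card_gt_0_iff)

abbreviation hom :: "('a \<times> 'a \<Rightarrow> real \<times> real \<Rightarrow> ennreal) \<Rightarrow> ennreal" where
  "hom f \<equiv> edge_integral unit_interval V D f"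

lemma hom_le_one:
  assumes "\<And>e. e \<in> D \<Longrightarrow> f e \<in> borel_measurable (unit_interval \<Otimes>\<^sub>M unit_interval)"
    and "\<And>e p. e \<in> D \<Longrightarrow> f e p \<le> B" and "B < \<infinity>"
    and "\<And>e. e \<in> D \<Longrightarrow> hom (\<lambda>_. f e) \<le> 1"
  shows "hom f \<le> 1"
  by (rule prob_space.edge_integral_le_one[OF prob_space_unit_interval finite_D Cauchy_Schwarz collapse e0])
    (use assms in auto)

lemma AE_cube_pair:
  assumes "AE p in lebesgue_on unit_square. P p" and ij: "(i, j) \<in> D"
  shows "AE x in PiM V (\<lambda>_. unit_interval). P (x i, x j)"
proof -
  have eq: "distr (PiM V (\<lambda>_. unit_interval)) (unit_interval \<Otimes>\<^sub>M unit_interval) (\<lambda>x. (x i, x j)) =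
      unit_interval \<Otimes>\<^sub>M unit_interval"
    by (rule prob_space.distr_pair_component[OF prob_space_unit_interval])
      (use ij edges loopless in auto)
  have "(\<lambda>x. (x i, x j)) \<in> PiM V (\<lambda>_. unit_interval) \<rightarrow>\<^sub>M unit_interval \<Otimes>\<^sub>M unit_interval"
    using ij edges by (intro measurable_Pair measurable_component_singleton) auto
  then show ?thesis
    by (rule AE_distrD) (use assms(1) in \<open>simp only: eq AE_unit_square\<close>)
qed

lemma AE_cube:
  assumes "AE p in lebesgue_on unit_square. P p"
  shows "AE x in PiM V (\<lambda>_. unit_interval). \<forall>(i, j)\<in>D. P (x i, x j)"
  using AE_cube_pair[OF assms] finite_D by (intro AE_finite_allI) auto

text \<open>An exceptional null set of the square pulls back along each edge to a null set of the
  cube, and there are finitely many edges. Passing to the completion does not change the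
  integral.\<close>

lemma LINT_cube_eq_hom:
  assumes g: "g \<in> borel_measurable (unit_interval \<Otimes>\<^sub>M unit_interval)"
    and nonneg: "\<And>p. 0 \<le> g p"
    and ae: "AE p in lebesgue_on unit_square. \<bar>f p\<bar> = g p"
  shows "(LINT x|cube_measure V. (\<Prod>(i, j)\<in>D. \<bar>f (x i, x j)\<bar>)) = enn2real (hom (\<lambda>_ p. ennreal (g p)))"
proof -
  let ?P = "PiM V (\<lambda>_. unit_interval)"
  let ?F = "\<lambda>x. \<Prod>(i, j)\<in>D. \<bar>f (x i, x j)\<bar>"
  let ?G = "\<lambda>x. \<Prod>e\<in>D. g (x (fst e), x (snd e))"
  have ae': "AE x in ?P. ?F x = ?G x"
    using AE_cube[OF ae] by eventually_elim (auto intro!: prod.cong)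
  have G: "?G \<in> borel_measurable ?P"
  proof (rule borel_measurable_prod)
    fix e assume "e \<in> D"
    then have "fst e \<in> V" "snd e \<in> V" using edges by auto
    then show "(\<lambda>x. g (x (fst e), x (snd e))) \<in> borel_measurable ?P"
      by (intro measurable_compose[OF _ g] measurable_Pair measurable_component_singleton)
  qed
  have "integral\<^sup>L (completion ?P) ?F = enn2real (\<integral>\<^sup>+ x. ennreal (?F x) \<partial>completion ?P)"
    by (intro integral_eq_nn_integral borel_measurable_completion_AE[OF G ae'])
      (auto intro!: prod_nonneg)
  also have "(\<integral>\<^sup>+ x. ennreal (?F x) \<partial>completion ?P) = (\<integral>\<^sup>+ x. ennreal (?F x) \<partial>?P)"
    by (rule nn_integral_completion)
  also have "\<dots> = (\<integral>\<^sup>+ x. ennreal (?G x) \<partial>?P)"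
    using ae' by (intro nn_integral_cong_AE) auto
  also have "\<dots> = hom (\<lambda>_ p. ennreal (g p))"
    unfolding edge_integral_def by (simp add: prod_ennreal nonneg)
  finally show ?thesis
    by (simp add: cube_measure_def)
qed

lemma hom_finite:
  assumes "\<And>p. f p \<le> B" and "B < \<infinity>"
  shows "hom (\<lambda>_. f) < \<infinity>"
proof -
  have "hom (\<lambda>_. f) \<le> B ^ card D"
    by (rule prob_space.edge_integral_le_power[OF prob_space_unit_interval]) (rule assms)
  also have "\<dots> < \<infinity>"
    using assms(2) by (simp add: power_less_top_ennreal)
  finally show ?thesis .
qed

lemma hom_cmult:
  assumes "f \<in> borel_measurable (unit_interval \<Otimes>\<^sub>M unit_interval)"
  shows "hom (\<lambda>_ p. c * f p) = c ^ card D * hom (\<lambda>_. f)"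
  using prob_space.edge_integral_cmult[OF prob_space_unit_interval edges, of "\<lambda>_. f" "\<lambda>_. c"] assms
  by simp

lemma hom_one: "hom (\<lambda>_ _. 1) = 1"
proof -
  interpret P: prob_space "PiM V (\<lambda>_. unit_interval)"
    by (rule prob_space_PiM) (rule prob_space_unit_interval)
  show ?thesis
    by (simp add: edge_integral_def P.emeasure_space_1)
qed

text \<open>Comparing with the family that is \<open>t * f\<close> on a single edge and \<open>1\<close> elsewhere bounds
  \<open>t * \<integral> f\<close> by \<open>1\<close>, for every \<open>t\<close>.\<close>

lemma hom_eq_zero_imp_AE:
  assumes f: "f \<in> borel_measurable (unit_interval \<Otimes>\<^sub>M unit_interval)"
    and bounded: "\<And>p. f p \<le> B" "B < \<infinity>" and zero: "hom (\<lambda>_. f) = 0"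
  shows "AE p in unit_interval \<Otimes>\<^sub>M unit_interval. f p = 0"
proof -
  let ?P = "PiM V (\<lambda>_. unit_interval)"
  obtain i j where ij: "e0 = (i, j)" by (cases e0)
  let ?J = "\<integral>\<^sup>+ x. f (x i, x j) \<partial>?P"
  have pair: "(\<lambda>x. (x i, x j)) \<in> ?P \<rightarrow>\<^sub>M unit_interval \<Otimes>\<^sub>M unit_interval"
    using e0 ij edges by (intro measurable_Pair measurable_component_singleton) auto
  have "of_nat n * ?J \<le> 1" for n
  proof -
    let ?f = "\<lambda>e p. if e = e0 then of_nat n * f p else 1"
    have "hom ?f = (\<integral>\<^sup>+ x. of_nat n * f (x i, x j) \<partial>?P)"
      unfolding edge_integral_def using finite_D e0
      by (intro nn_integral_cong) (simp add: prod.delta ij)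
    also have "\<dots> = of_nat n * ?J"
      by (intro nn_integral_cmult measurable_compose[OF pair f])
    finally have "hom ?f = of_nat n * ?J" .
    moreover have "hom ?f \<le> 1"
    proof (rule hom_le_one[where B = "of_nat n * B + 1"])
      show "?f e \<in> borel_measurable (unit_interval \<Otimes>\<^sub>M unit_interval)" for e
        using f by (cases "e = e0") auto
      show "?f e p \<le> of_nat n * B + 1" for e p
        using mult_left_mono[OF bounded(1)[of p], of "of_nat n"]
        by (cases "e = e0") (auto intro: add_increasing add_increasing2)
      show "of_nat n * B + 1 < \<infinity>"
        using bounded(2) by (simp add: ennreal_mult_less_top of_nat_less_top)
      \<comment> \<open>Here the vanishing of \<open>hom\<close> is used: the constant family of
        \<open>n * f\<close> has integral \<open>n ^ card D * 0 = 0\<close>, so every multiple of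
        \<open>f\<close> is admissible.\<close>
      show "hom (\<lambda>_. ?f e) \<le> 1" for e
        using hom_cmult[OF f, of "of_nat n"] zero hom_one by (cases "e = e0") auto
    qed
    ultimately show ?thesis by simp
  qed
  then have "?J = 0"
    by (rule ennreal_eq_0_if_multiples_bounded)
  then have "(\<integral>\<^sup>+ p. f p \<partial>distr ?P (unit_interval \<Otimes>\<^sub>M unit_interval) (\<lambda>x. (x i, x j))) = 0"
    using f by (subst nn_integral_distr[OF pair]) auto
  then have "(\<integral>\<^sup>+ p. f p \<partial>(unit_interval \<Otimes>\<^sub>M unit_interval)) = 0"
    using e0 ij edges loopless
    by (subst (asm) prob_space.distr_pair_component[OF prob_space_unit_interval]) auto
  then show ?thesis
    using nn_integral_0_iff_AE[OF f] by simp
qed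

text \<open>Dividing \<open>f\<close> by \<open>a\<close> and \<open>g\<close> by \<open>b\<close>
  normalises both, so every mixed family falls under the Hoelder inequality; strict positivity of
  \<open>a\<close> and \<open>b\<close> permits the division.\<close>

lemma hom_add_le:
  fixes f g :: "real \<times> real \<Rightarrow> real"
  assumes f: "f \<in> borel_measurable (unit_interval \<Otimes>\<^sub>M unit_interval)" "\<And>p. 0 \<le> f p" "\<And>p. f p \<le> B"
    and g: "g \<in> borel_measurable (unit_interval \<Otimes>\<^sub>M unit_interval)" "\<And>p. 0 \<le> g p" "\<And>p. g p \<le> C"
    and a: "0 < a" "hom (\<lambda>_ p. ennreal (f p)) \<le> ennreal a ^ card D"
    and b: "0 < b" "hom (\<lambda>_ p. ennreal (g p)) \<le> ennreal b ^ card D"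
  shows "hom (\<lambda>_ p. ennreal (f p + g p)) \<le> ennreal (a + b) ^ card D"
proof -
  have scaled: "hom (\<lambda>_ p. ennreal (h p / c)) \<le> 1"
    if "h \<in> borel_measurable (unit_interval \<Otimes>\<^sub>M unit_interval)" "0 < c" "\<And>p. 0 \<le> h p"
      "hom (\<lambda>_ p. ennreal (h p)) \<le> ennreal c ^ card D" for h c
  proof -
    have "hom (\<lambda>_ p. ennreal (h p / c)) = hom (\<lambda>_ p. ennreal (1 / c) * ennreal (h p))"
      using that by (intro edge_integral_cong ext) (simp add: ennreal_mult[symmetric])
    also have "\<dots> = ennreal (1 / c) ^ card D * hom (\<lambda>_ p. ennreal (h p))"
      by (rule hom_cmult) (use that in measurable)
    also have "\<dots> \<le> ennreal (1 / c) ^ card D * ennreal c ^ card D"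
      by (intro mult_left_mono that) simp
    also have "\<dots> = 1"
      using that by (simp add: power_mult_distrib[symmetric] ennreal_mult[symmetric])
    finally show ?thesis .
  qed
  have "hom (\<lambda>_ p. ennreal (f p + g p)) =
      hom (\<lambda>_ p. ennreal a * ennreal (f p / a) + ennreal b * ennreal (g p / b))"
    using a b f g
    by (intro edge_integral_cong ext) (simp add: ennreal_mult[symmetric] ennreal_plus[symmetric] del: ennreal_plus)
  also have "\<dots> \<le> (ennreal a + ennreal b) ^ card D"
  proof (rule prob_space.edge_integral_add_le[OF prob_space_unit_interval finite_D edges])
    show mf: "(\<lambda>p. ennreal (f p / a)) \<in> borel_measurable (unit_interval \<Otimes>\<^sub>M unit_interval)"
      using f by measurable
    show mg: "(\<lambda>p. ennreal (g p / b)) \<in> borel_measurable (unit_interval \<Otimes>\<^sub>M unit_interval)"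
      using g by measurable
    fix X :: "('a \<times> 'a) set"
    let ?h = "\<lambda>e. if e \<in> X then \<lambda>p. ennreal (f p / a) else (\<lambda>p. ennreal (g p / b))"
    show "hom ?h \<le> 1"
    proof (rule hom_le_one[where B = "ennreal (B / a) + ennreal (C / b)"])
      show "?h e \<in> borel_measurable (unit_interval \<Otimes>\<^sub>M unit_interval)" for e
        using mf mg by simp
      show "?h e p \<le> ennreal (B / a) + ennreal (C / b)" for e p
        using f(3)[of p] g(3)[of p] a b
        by (cases "e \<in> X")
          (simp_all add: add_increasing add_increasing2 ennreal_leI divide_right_mono)
      show "hom (\<lambda>_. ?h e) \<le> 1" for e
        using scaled[OF f(1) a(1) f(2) a(2)] scaled[OF g(1) b(1) g(2) b(2)] by simp
    qed simp
  qed
  finally show ?thesis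
    using a b by (simp add: ennreal_plus)
qed

section \<open>From the integral to the norm axioms\<close>

lemma r_norm_eq:
  assumes "card E = card D"
    and "g \<in> borel_measurable (unit_interval \<Otimes>\<^sub>M unit_interval)" "\<And>p. 0 \<le> g p"
    and "AE p in lebesgue_on unit_square. \<bar>f p\<bar> = g p"
  shows "r_norm V E D f = enn2real (hom (\<lambda>_ p. ennreal (g p))) powr (1 / card D)"
  unfolding r_norm_def LINT_cube_eq_hom[OF assms(2-4)] assms(1) ..

lemma hom_eq_r_norm_power:
  assumes E: "card E = card D"
    and g: "g \<in> borel_measurable (unit_interval \<Otimes>\<^sub>M unit_interval)" "\<And>p. 0 \<le> g p" "\<And>p. g p \<le> B"
    and ae: "AE p in lebesgue_on unit_square. \<bar>f p\<bar> = g p"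
  shows "hom (\<lambda>_ p. ennreal (g p)) = ennreal (r_norm V E D f) ^ card D"
proof -
  let ?r = "enn2real (hom (\<lambda>_ p. ennreal (g p)))"
  have "hom (\<lambda>_ p. ennreal (g p)) < \<infinity>"
    by (rule hom_finite[where B = "ennreal B"]) (use g in \<open>auto intro: ennreal_leI\<close>)
  then have "hom (\<lambda>_ p. ennreal (g p)) = ennreal ?r"
    by simp
  \<comment> \<open>At zero, \<open>powr\<close> has the value 0 by definition, and
    \<open>0 ^ card D = 0\<close> because there is an edge; for positive values the exponents
    cancel.\<close>
  also have "?r = (?r powr (1 / card D)) ^ card D"
    using card_pos by (cases "?r = 0") (auto simp: powr_powr simp flip: powr_realpow)
  also have "ennreal \<dots> = ennreal (r_norm V E D f) ^ card D"
    unfolding r_norm_eq[OF E g(1,2) ae] by (simp add: ennreal_power)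
  finally show ?thesis .
qed

lemma r_norm_nonneg: "0 \<le> r_norm V E D f"
  by (simp add: r_norm_def)

lemma r_norm_scale:
  assumes E: "card E = card D"
  shows "r_norm V E D (\<lambda>p. c * f p) = \<bar>c\<bar> * r_norm V E D f"
proof -
  let ?I = "\<lambda>f. LINT x|cube_measure V. (\<Prod>(i, j)\<in>D. \<bar>f (x i, x j)\<bar>)"
  have "?I (\<lambda>p. c * f p) = (LINT x|cube_measure V. \<bar>c\<bar> ^ card D * (\<Prod>(i, j)\<in>D. \<bar>f (x i, x j)\<bar>))"
    by (simp add: abs_mult case_prod_beta' prod.distrib)
  then have "?I (\<lambda>p. c * f p) = \<bar>c\<bar> ^ card D * ?I f"
    by simp
  moreover have "0 \<le> ?I f"
    by (intro integral_nonneg_AE AE_I2 prod_nonneg) auto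
  moreover have "(\<bar>c\<bar> ^ card D) powr (1 / card D) = \<bar>c\<bar>"
    using card_pos by (cases "c = 0") (auto simp: powr_powr simp flip: powr_realpow)
  ultimately show ?thesis
    by (simp add: r_norm_def E powr_mult)
qed

lemma r_norm_eq_0_iff:
  assumes E: "card E = card D" and f: "f \<in> bounded_measurable"
  shows "r_norm V E D f = 0 \<longleftrightarrow> (AE p in lebesgue_on unit_square. f p = 0)"
proof
  obtain g B where g: "g \<in> borel_measurable (unit_interval \<Otimes>\<^sub>M unit_interval)"
      "\<And>p. 0 \<le> g p" "\<And>p. g p \<le> (B :: real)"
    and ae: "AE p in lebesgue_on unit_square. \<bar>f p\<bar> = g p"
    using bounded_measurable_Borel_version[OF f] by blast
  assume "r_norm V E D f = 0"
  then have "hom (\<lambda>_ p. ennreal (g p)) = 0"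
    using hom_eq_r_norm_power[OF E g ae] card_pos by (simp add: zero_power)
  then have "AE p in unit_interval \<Otimes>\<^sub>M unit_interval. ennreal (g p) = 0"
    using g by (intro hom_eq_zero_imp_AE[where B = "ennreal B"]) (auto intro: ennreal_leI)
  then have "AE p in lebesgue_on unit_square. ennreal (g p) = 0"
    by (simp only: AE_unit_square)
  with ae show "AE p in lebesgue_on unit_square. f p = 0"
    by eventually_elim (use g(2) in \<open>force simp: antisym\<close>)
next
  assume ae: "AE p in lebesgue_on unit_square. f p = 0"
  then have "AE p in lebesgue_on unit_square. \<bar>f p\<bar> = 0"
    by simp
  from r_norm_eq[OF E _ _ this] show "r_norm V E D f = 0"
    using card_pos by (simp add: edge_integral_def power_0_left)
qed

lemma r_norm_triangle:
  assumes E: "card E = card D" and "f \<in> bounded_measurable" and "g \<in> bounded_measurable"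
  shows "r_norm V E D (\<lambda>p. f p + g p) \<le> r_norm V E D f + r_norm V E D g"
proof (rule field_le_epsilon)
  obtain f' B where f': "f' \<in> borel_measurable (unit_interval \<Otimes>\<^sub>M unit_interval)"
      "\<And>p. 0 \<le> f' p" "\<And>p. f' p \<le> (B :: real)"
    and aef: "AE p in lebesgue_on unit_square. \<bar>f p\<bar> = f' p"
    using bounded_measurable_Borel_version[OF assms(2)] by blast
  obtain g' C where g': "g' \<in> borel_measurable (unit_interval \<Otimes>\<^sub>M unit_interval)"
      "\<And>p. 0 \<le> g' p" "\<And>p. g' p \<le> (C :: real)"
    and aeg: "AE p in lebesgue_on unit_square. \<bar>g p\<bar> = g' p"
    using bounded_measurable_Borel_version[OF assms(3)] by blast
  have "(\<lambda>p. f p + g p) \<in> bounded_measurable"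
    using assms(2,3) by (auto simp: bounded_measurable_def intro!: bounded_plus_comp)
  then obtain h' H where h': "h' \<in> borel_measurable (unit_interval \<Otimes>\<^sub>M unit_interval)"
      "\<And>p. 0 \<le> h' p" "\<And>p. h' p \<le> (H :: real)"
    and aeh: "AE p in lebesgue_on unit_square. \<bar>f p + g p\<bar> = h' p"
    using bounded_measurable_Borel_version by blast
  fix e :: real assume e: "0 < e"
  \<comment> \<open>The slack of \<open>e / 2\<close> makes both bounds strictly positive even if
    one of the norms is zero, so that scaling by their inverses is possible.\<close>
  define a where "a = r_norm V E D f + e / 2"
  define b where "b = r_norm V E D g + e / 2"
  have ab: "0 < a" "0 < b" "r_norm V E D f \<le> a" "r_norm V E D g \<le> b"
    using e r_norm_nonneg[of E] by (auto simp: a_def b_def add_nonneg_pos)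
  have "AE p in lebesgue_on unit_square. h' p \<le> f' p + g' p"
    using aef aeg aeh by eventually_elim (use abs_triangle_ineq in metis)
  from AE_cube[OF this] have "hom (\<lambda>_ p. ennreal (h' p)) \<le> hom (\<lambda>_ p. ennreal (f' p + g' p))"
    unfolding edge_integral_def
    by (intro nn_integral_mono_AE, elim eventually_mono)
      (force intro!: prod_mono_ennreal ennreal_leI)
  also have "\<dots> \<le> ennreal (a + b) ^ card D"
  proof (rule hom_add_le[OF f' g' ab(1) _ ab(2)])
    show "hom (\<lambda>_ p. ennreal (f' p)) \<le> ennreal a ^ card D"
      unfolding hom_eq_r_norm_power[OF E f' aef] using ab by (intro power_mono_ennreal ennreal_leI)
    show "hom (\<lambda>_ p. ennreal (g' p)) \<le> ennreal b ^ card D"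
      unfolding hom_eq_r_norm_power[OF E g' aeg] using ab by (intro power_mono_ennreal ennreal_leI)
  qed
  finally have "ennreal (r_norm V E D (\<lambda>p. f p + g p)) ^ card D \<le> ennreal (a + b) ^ card D"
    unfolding hom_eq_r_norm_power[OF E h' aeh] .
  then have "r_norm V E D (\<lambda>p. f p + g p) ^ card D \<le> (a + b) ^ card D"
    using ab r_norm_nonneg by (simp add: ennreal_power del: ennreal_plus)
  then have "r_norm V E D (\<lambda>p. f p + g p) \<le> a + b"
    using ab card_pos r_norm_nonneg by (subst (asm) power_mono_iff) auto
  also have "\<dots> = r_norm V E D f + r_norm V E D g + e"
    by (simp add: a_def b_def)
  finally show "r_norm V E D (\<lambda>p. f p + g p) \<le> r_norm V E D f + r_norm V E D g + e" .
qed

lemma is_norm_r_norm: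
  assumes "card E = card D"
  shows "is_norm_on_bounded_measurable (r_norm V E D)"
  unfolding is_norm_on_bounded_measurable_def
  using r_norm_nonneg r_norm_eq_0_iff[OF assms] r_norm_scale[OF assms] r_norm_triangle[OF assms]
  by blast

end

section \<open>Foldings of graphs\<close>

text \<open>Pulling back along \<open>p\<close> and then along \<open>q\<close> is pulling back
  along \<open>p \<circ> q\<close>, so the foldings on the path from the root are composed with the
  first one outermost.\<close>

lemma leaf_labels_cauchy_schwarz_tree:
  assumes "\<psi> \<in> leaf_labels (cauchy_schwarz_tree L R \<phi>s \<kappa>)"
  obtains ps where "set ps \<subseteq> (\<Union>\<phi>\<in>set \<phi>s. {fold_away \<phi> (R \<phi>), fold_away \<phi> (L \<phi>)})"
    and "\<psi> = pull_colouring \<kappa> (foldr (\<circ>) ps id)"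
proof -
  have "\<exists>ps. set ps \<subseteq> (\<Union>\<phi>\<in>set \<phi>s. {fold_away \<phi> (R \<phi>), fold_away \<phi> (L \<phi>)}) \<and>
      \<psi> = pull_colouring \<kappa> (foldr (\<circ>) ps id)"
    using assms
  proof (induction \<phi>s arbitrary: \<kappa>)
    case Nil
    then show ?case
      by (intro exI[of _ "[]"]) (simp add: pull_colouring_def fun_eq_iff)
  next
    case (Cons \<phi> \<phi>s)
    then obtain p where p: "p \<in> {fold_away \<phi> (R \<phi>), fold_away \<phi> (L \<phi>)}"
      and "\<psi> \<in> leaf_labels (cauchy_schwarz_tree L R \<phi>s (pull_colouring \<kappa> p))"
      by auto
    from Cons.IH[OF this(2)] obtain ps
      where ps: "set ps \<subseteq> (\<Union>\<phi>\<in>set \<phi>s. {fold_away \<phi> (R \<phi>), fold_away \<phi> (L \<phi>)})"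
        and "\<psi> = pull_colouring (pull_colouring \<kappa> p) (foldr (\<circ>) ps id)"
      by blast
    then have "\<psi> = pull_colouring \<kappa> (foldr (\<circ>) (p # ps) id)"
      by (simp add: pull_colouring_def fun_eq_iff image_comp)
    moreover have "set (p # ps) \<subseteq> (\<Union>\<phi>\<in>set (\<phi> # \<phi>s). {fold_away \<phi> (R \<phi>), fold_away \<phi> (L \<phi>)})"
      using p ps by auto
    ultimately show ?case by blast
  qed
  with that show ?thesis by blast
qed

text \<open>If nothing were fixed, nothing would be removed, and the connected graph itself would
  have to be disconnected.\<close>

lemma cut_involution_has_fixed_vertex:
  assumes "graph_connected V E" and "cut_involution V E \<phi>"
  obtains w where "w \<in> V" and "\<phi> w = w"
proof -
  have "fixed_set V \<phi> \<noteq> {}"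
    using assms by (auto simp: cut_involution_def vertex_cut_def remaining_edges_def)
  with that show ?thesis
    by (auto simp: fixed_set_def)
qed

lemma automorphism_edge:
  assumes "graph_automorphism V E \<phi>" and "{u, v} \<in> E" and "u \<in> V" and "v \<in> V"
  shows "{\<phi> u, \<phi> v} \<in> E"
  using assms by (simp add: graph_automorphism_def)

lemma edge_in_V:
  assumes "simple_graph V E" and "{u, v} \<in> E"
  shows "u \<in> V" and "v \<in> V" and "u \<noteq> v"
  using assms by (fastforce simp: simple_graph_def doubleton_eq_iff)+

section \<open>Foldings as edge-preserving maps\<close>

locale graph_folding =
  fixes V :: "'a set" and E :: "'a set set" and \<phi> :: "'a \<Rightarrow> 'a" and L R :: "'a set"
  assumes graph: "simple_graph V E" and inv: "cut_involution V E \<phi>"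
    and halves: "folding_halves V E \<phi> L R"
begin

abbreviation "F \<equiv> fixed_set V \<phi>"

lemma halves_image: "\<phi> ` L = R"
  using halves by (simp add: folding_halves_def Let_def)

lemma halves_disjoint: "F \<inter> L = {}" "F \<inter> R = {}" "L \<inter> R = {}"
  and halves_cover: "F \<union> L \<union> R = V"
proof -
  have "L \<inter> R = {}" "L \<union> R = V - F"
    using halves by (simp_all add: folding_halves_def Let_def)
  moreover have "F \<subseteq> V"
    by (auto simp: fixed_set_def)
  ultimately show "F \<inter> L = {}" "F \<inter> R = {}" "L \<inter> R = {}" "F \<union> L \<union> R = V"
    by blast+
qed

lemma involutive: "v \<in> V \<Longrightarrow> \<phi> (\<phi> v) = v"
  using inv by (simp add: cut_involution_def)

lemma halves_image': "\<phi> ` R = L"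
proof -
  have "\<phi> ` R = (\<lambda>v. \<phi> (\<phi> v)) ` L"
    unfolding halves_image[symmetric] by (simp add: image_comp comp_def)
  also have "\<dots> = L"
    using involutive halves_cover by force
  finally show ?thesis .
qed

lemma swapped: "graph_folding V E \<phi> R L"
  using graph inv halves halves_image'
  by unfold_locales (simp_all add: folding_halves_def Let_def Int_commute Un_commute)

lemma edge_image:
  assumes "{u, v} \<in> E"
  shows "{\<phi> u, \<phi> v} \<in> E"
  by (rule automorphism_edge[OF _ assms])
    (use inv edge_in_V[OF graph assms] in \<open>simp_all add: cut_involution_def\<close>)

text \<open>Both ends of such an edge survive the removal of \<open>F\<close> and lie in one
  component, which is contained in \<open>L\<close> as soon as it meets \<open>L\<close>.\<close>

lemma no_crossing_edge:
  assumes "{u, v} \<in> E" and "u \<in> L" and "v \<in> R"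
  shows False
proof -
  obtain \<A> where A: "\<A> \<subseteq> graph_components (V - F) (remaining_edges E F)" "L = \<Union>\<A>"
    using halves by (auto simp: folding_halves_def Let_def)
  with \<open>u \<in> L\<close> obtain C where C: "C \<in> \<A>" "u \<in> C"
    by blast
  with A(1) obtain x where x: "C = {w \<in> V - F. (x, w) \<in> (adj (remaining_edges E F))\<^sup>*}"
    by (auto simp: graph_components_def)
  have "{u, v} \<in> remaining_edges E F"
    using assms halves_disjoint by (auto simp: remaining_edges_def)
  then have "(u, v) \<in> adj (remaining_edges E F)"
    by (simp add: adj_def)
  with C(2) have "(x, v) \<in> (adj (remaining_edges E F))\<^sup>*"
    unfolding x by (auto intro: rtrancl_into_rtrancl)
  moreover have "v \<in> V - F"
    using \<open>v \<in> R\<close> halves_disjoint halves_cover by auto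
  ultimately have "v \<in> L"
    using A(2) C(1) x by auto
  with \<open>v \<in> R\<close> halves_disjoint show False by blast
qed

lemma edge_side:
  assumes "{u, v} \<in> E"
  shows "u \<in> F \<union> L \<and> v \<in> F \<union> L \<or> u \<in> F \<union> R \<and> v \<in> F \<union> R"
proof -
  have "u \<in> F \<union> L \<union> R" "v \<in> F \<union> L \<union> R"
    using edge_in_V[OF graph assms] halves_cover by auto
  moreover have "\<not> (u \<in> L \<and> v \<in> R)" "\<not> (v \<in> L \<and> u \<in> R)"
    using no_crossing_edge[of u v] no_crossing_edge[of v u] assms by (auto simp: insert_commute)
  ultimately show ?thesis by blast
qed

text \<open>An edge lies within one closed side, so the folding acts on both of its ends as the
  identity or on both as the automorphism \<phi>.\<close>

lemma fold_edge:
  assumes "{u, v} \<in> E"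
  shows "{fold_away \<phi> R u, fold_away \<phi> R v} \<in> E"
  using edge_side[OF assms]
proof
  assume "u \<in> F \<union> L \<and> v \<in> F \<union> L"
  then show ?thesis
    using halves_disjoint assms by (auto simp: fold_away_def)
next
  assume "u \<in> F \<union> R \<and> v \<in> F \<union> R"
  then have "fold_away \<phi> R u = \<phi> u" "fold_away \<phi> R v = \<phi> v"
    by (auto simp: fold_away_def fixed_set_def)
  then show ?thesis
    using edge_image[OF assms] by simp
qed

end

text \<open>A cut involution of a connected graph fixes a vertex, so it cannot exchange the two classes
  of a bipartition.\<close>

lemma cut_involution_preserves_colour:
  assumes graph: "simple_graph V E" and conn: "graph_connected V E" and inv: "cut_involution V E \<phi>"
    and proper: "\<And>u v. {u, v} \<in> E \<Longrightarrow> c u \<noteq> (c v :: bool)" and "v \<in> V"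
  shows "c (\<phi> v) = c v"
proof -
  obtain w where w: "w \<in> V" "\<phi> w = w"
    by (rule cut_involution_has_fixed_vertex[OF conn inv])
  have "(w, v) \<in> (adj E)\<^sup>*"
    using conn w(1) \<open>v \<in> V\<close> by (auto simp: graph_connected_def)
  then show ?thesis
  proof (induction rule: rtrancl_induct)
    case base
    then show ?case using w by simp
  next
    case (step y z)
    then have yz: "{y, z} \<in> E"
      by (simp add: adj_def)
    have "{\<phi> y, \<phi> z} \<in> E"
      by (rule automorphism_edge[OF _ yz])
        (use inv edge_in_V[OF graph yz] in \<open>simp_all add: cut_involution_def\<close>)
    \<comment> \<open>With only two colours, both \<open>z\<close> and its image have the colour
      opposite to that of \<open>y\<close> and its image.\<close>
    with proper[OF yz] proper[OF this] step.IH show ?case by blast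
  qed
qed

text \<open>Since \<phi> keeps the colour classes, it and both foldings map directed edges to
  directed edges, so the reflection inequality applies to the oriented edge set.\<close>

lemma (in graph_folding) Cauchy_Schwarz_map_fold_away:
  assumes conn: "graph_connected V E" and "prob_space M"
    and proper: "\<And>u v. {u, v} \<in> E \<Longrightarrow> c u \<noteq> c v"
  shows "Cauchy_Schwarz_map (M :: 'b measure) V {(u, v). {u, v} \<in> E \<and> c u \<and> \<not> c v} (fold_away \<phi> R)"
proof -
  let ?D = "{(u, v). {u, v} \<in> E \<and> c u \<and> \<not> c v}"
  interpret S: graph_folding V E \<phi> R L by (rule swapped)
  have colour: "c (\<phi> v) = c v" if "v \<in> V" for v
    by (rule cut_involution_preserves_colour[OF graph conn inv proper that])
  then have fold_colour: "c (fold_away \<phi> A v) = c v" if "v \<in> V" for A v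
    using that by (simp add: fold_away_def)
  interpret prob_space M by fact
  have finV: "finite V"
    using graph by (simp add: simple_graph_def)
  interpret edge_reflection M F L R ?D \<phi>
  proof unfold_locales
    show "finite F" "finite L" "finite R"
      using finV halves_cover by (auto intro: finite_subset)
    show "F \<inter> L = {}" "F \<inter> R = {}" "L \<inter> R = {}"
      by (rule halves_disjoint)+
    show "\<phi> v = v" if "v \<in> F" for v
      using that by (simp add: fixed_set_def)
    show "\<phi> ` L = R" "\<phi> ` R = L"
      by (rule halves_image halves_image')+
    show "\<phi> (\<phi> v) = v" if "v \<in> L \<union> R" for v
      using that halves_cover by (intro involutive) auto
    show "?D \<subseteq> (F \<union> L) \<times> (F \<union> L) \<union> (F \<union> R) \<times> (F \<union> R)"
      by (auto dest!: edge_side)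
    show "map_prod \<phi> \<phi> ` ?D \<subseteq> ?D"
    proof (rule image_subsetI)
      fix e assume "e \<in> ?D"
      then obtain u v where e: "e = (u, v)" "{u, v} \<in> E" "c u" "\<not> c v"
        by blast
      with colour edge_image edge_in_V[OF graph e(2)] show "map_prod \<phi> \<phi> e \<in> ?D"
        by simp
    qed
  qed
  have pD: "map_prod p p \<in> ?D \<rightarrow> ?D"
    if "\<And>u v. {u, v} \<in> E \<Longrightarrow> {p u, p v} \<in> E" "\<And>v. v \<in> V \<Longrightarrow> c (p v) = c v" for p
  proof (rule Pi_I)
    fix e assume "e \<in> ?D"
    then obtain u v where e: "e = (u, v)" "{u, v} \<in> E" "c u" "\<not> c v"
      by blast
    with that edge_in_V[OF graph e(2)] show "map_prod p p e \<in> ?D"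
      by simp
  qed
  show ?thesis
    unfolding Cauchy_Schwarz_map_def
  proof (intro conjI exI allI impI)
    show "map_prod (fold_away \<phi> R) (fold_away \<phi> R) \<in> ?D \<rightarrow> ?D"
      by (rule pD[OF fold_edge fold_colour])
    show "map_prod (fold_away \<phi> L) (fold_away \<phi> L) \<in> ?D \<rightarrow> ?D"
      by (rule pD[OF S.fold_edge fold_colour])
    fix f :: "'a \<times> 'a \<Rightarrow> 'b \<times> 'b \<Rightarrow> ennreal"
    assume "\<forall>e\<in>?D. f e \<in> borel_measurable (M \<Otimes>\<^sub>M M)"
    then show "(edge_integral M V ?D f)\<^sup>2 \<le>
        edge_integral M V ?D (\<lambda>e. f (map_prod (fold_away \<phi> R) (fold_away \<phi> R) e)) *
        edge_integral M V ?D (\<lambda>e. f (map_prod (fold_away \<phi> L) (fold_away \<phi> L) e))"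
      using edge_integral_Cauchy_Schwarz[of f] unfolding halves_cover by blast
  qed
qed

section \<open>From a monochromatic leaf to a collapsing homomorphism\<close>

theorem theorem3p2:
  fixes V :: "'a set" and E :: "'a set set" and m :: nat
    and L R :: "('a \<Rightarrow> 'a) \<Rightarrow> 'a set" and \<phi>s :: "('a \<Rightarrow> 'a) list"
    and \<kappa> :: "'a set \<Rightarrow> nat"
  assumes "simple_graph V E" and "graph_connected V E" and "card E = m"
    and "edge_transitive V E"
    and "\<And>\<phi>. \<phi> \<in> set \<phi>s \<Longrightarrow> cut_involution V E \<phi>"
    and "\<And>\<phi>. \<phi> \<in> set \<phi>s \<Longrightarrow> folding_halves V E \<phi> (L \<phi>) (R \<phi>)"
    and "rainbow E m \<kappa>"
    and "\<exists>\<psi> \<in> leaf_labels (cauchy_schwarz_tree L R \<phi>s \<kappa>). monochromatic E \<psi>"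
  shows "weakly_norming V E"
proof -
  obtain \<psi> where "\<psi> \<in> leaf_labels (cauchy_schwarz_tree L R \<phi>s \<kappa>)" and mono: "monochromatic E \<psi>"
    using assms(8) by blast
  then obtain ps where ps: "set ps \<subseteq> (\<Union>\<phi>\<in>set \<phi>s. {fold_away \<phi> (R \<phi>), fold_away \<phi> (L \<phi>)})"
    and \<psi>: "\<psi> = pull_colouring \<kappa> (foldr (\<circ>) ps id)"
    by (elim leaf_labels_cauchy_schwarz_tree)
  define h where "h = foldr (\<circ>) ps id"
  \<comment> \<open>Either child is a folding away from the second half, if the two halves are
    exchanged where necessary.\<close>
  have fold: "\<exists>\<phi> A B. graph_folding V E \<phi> A B \<and> p = fold_away \<phi> B" if p: "p \<in> set ps" for p
  proof -
    obtain \<phi> where \<phi>: "\<phi> \<in> set \<phi>s" "p = fold_away \<phi> (R \<phi>) \<or> p = fold_away \<phi> (L \<phi>)"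
      using subsetD[OF ps p] by auto
    then interpret graph_folding V E \<phi> "L \<phi>" "R \<phi>"
      using assms by unfold_locales auto
    show ?thesis
      using \<phi>(2) swapped graph_folding_axioms by blast
  qed
  have edge_foldr: "{foldr (\<circ>) qs id u, foldr (\<circ>) qs id v} \<in> E" if "set qs \<subseteq> set ps" "{u, v} \<in> E" for qs u v
    using that
  proof (induction qs)
    case (Cons p qs)
    then obtain \<phi> A B where p: "graph_folding V E \<phi> A B" "p = fold_away \<phi> B"
      using fold[of p] by auto
    have "{foldr (\<circ>) qs id u, foldr (\<circ>) qs id v} \<in> E"
      by (rule Cons.IH) (use Cons.prems in auto)
    moreover have "foldr (\<circ>) (p # qs) id x = fold_away \<phi> B (foldr (\<circ>) qs id x)" for x
      by (simp add: p(2))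
    ultimately show ?case
      using graph_folding.fold_edge[OF p(1)] by (simp only:)
  qed simp
  obtain k where k: "\<psi> ` E = {k}"
    using mono by (auto simp: monochromatic_def)
  then obtain e where e: "e \<in> E" by blast
  then obtain u v where uv: "{u, v} \<in> E"
    using assms(1) by (auto simp: simple_graph_def)
  define a b where "a = h u" and "b = h v"
  have ab: "{a, b} \<in> E"
    using edge_foldr[of ps u v] uv by (simp add: a_def b_def h_def)
  then have "a \<noteq> b"
    by (rule edge_in_V(3)[OF assms(1)])
  \<comment> \<open>The leaf colours an edge by the rainbow colour of its image under
    \<open>h\<close>. The rainbow colouring is injective on \<open>E\<close>, so equal colours at
    the leaf force equal images.\<close>
  have h: "{h x, h y} = {a, b}" if "{x, y} \<in> E" for x y
  proof -
    have "\<psi> {x, y} = k" "\<psi> {u, v} = k"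
      using k that uv by auto
    then have "\<kappa> {h x, h y} = \<kappa> {a, b}"
      by (simp add: \<psi> pull_colouring_def h_def a_def b_def)
    moreover have "inj_on \<kappa> E"
      using assms(7) by (simp add: rainbow_def bij_betw_def)
    ultimately show ?thesis
      using ab edge_foldr[of ps x y] that by (auto simp: h_def inj_on_eq_iff)
  qed
  \<comment> \<open>The preimages of the two ends of the target edge are the classes of a
    bipartition.\<close>
  define c where "c x \<longleftrightarrow> h x = a" for x
  have proper: "c x \<noteq> c y" if "{x, y} \<in> E" for x y
    using h[OF that] \<open>a \<noteq> b\<close> by (auto simp: c_def doubleton_eq_iff)
  define D where "D = {(u, v). {u, v} \<in> E \<and> c u \<and> \<not> c v}"
  have orient: "orientation E D"
    unfolding orientation_def bij_betw_def
  proof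
    show "inj_on (\<lambda>(u, v). {u, v}) D"
      by (auto simp: inj_on_def D_def doubleton_eq_iff)
    have "{x, y} \<in> (\<lambda>(u, v). {u, v}) ` D" if "{x, y} \<in> E" for x y
    proof (cases "c x")
      case True
      then show ?thesis
        using that proper[OF that] by (intro image_eqI[of _ _ "(x, y)"]) (auto simp: D_def)
    next
      case False
      then show ?thesis
        using that proper[OF that] by (intro image_eqI[of _ _ "(y, x)"]) (auto simp: D_def insert_commute)
    qed
    then show "(\<lambda>(u, v). {u, v}) ` D = E"
      using assms(1) by (fastforce simp: D_def simple_graph_def)
  qed
  have cs: "Cauchy_Schwarz_map unit_interval V D p" if "p \<in> set ps" for p
    using fold[OF that] graph_folding.Cauchy_Schwarz_map_fold_away[OF _ assms(2) prob_space_unit_interval proper]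
    by (auto simp: D_def)
  have collapse: "map_prod h h x = (a, b)" if xD: "x \<in> D" for x
  proof -
    obtain u v where x: "x = (u, v)" "{u, v} \<in> E" "h u = a" "h v \<noteq> a"
      using xD by (auto simp: D_def c_def)
    with h[OF x(2)] show ?thesis
      by (auto simp: doubleton_eq_iff)
  qed
  \<comment> \<open>That \<open>(a, b)\<close> itself is directed correctly means
    \<open>h a = a\<close>, which does not follow from \<open>{a, b} \<in> E\<close>. It holds
    because the foldings map \<open>D\<close> into \<open>D\<close> and their composition sends any
    element of the nonempty set \<open>D\<close> to \<open>(a, b)\<close>.\<close>
  have "map_prod (foldr (\<circ>) qs id) (foldr (\<circ>) qs id) x \<in> D" if "set qs \<subseteq> set ps" "x \<in> D" for qs x
    using that
  proof (induction qs)
    case (Cons p qs)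
    then have p: "map_prod p p \<in> D \<rightarrow> D"
      using cs[of p] by (simp add: Cauchy_Schwarz_map_def)
    have "map_prod (foldr (\<circ>) qs id) (foldr (\<circ>) qs id) x \<in> D"
      by (rule Cons.IH) (use Cons.prems in auto)
    note Pi_mem[OF p this]
    moreover have "map_prod (foldr (\<circ>) (p # qs) id) (foldr (\<circ>) (p # qs) id) x =
        map_prod p p (map_prod (foldr (\<circ>) qs id) (foldr (\<circ>) qs id) x)"
      by (cases x) simp
    ultimately show ?case
      by (simp only:)
  qed (cases x, auto)
  moreover have "D \<noteq> {}"
    using orient e by (auto simp: orientation_def bij_betw_def)
  ultimately have "(a, b) \<in> D"
    using collapse unfolding h_def by (metis equals0I subset_refl)
  interpret collapsible_edges V D ps "(a, b)"
  proof unfold_locales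
    show "finite V"
      using assms(1) by (simp add: simple_graph_def)
    show "D \<subseteq> V \<times> V"
      using edge_in_V[OF assms(1)] by (auto simp: D_def)
  qed (use cs collapse \<open>(a, b) \<in> D\<close> in \<open>auto simp: D_def h_def\<close>)
  have "card E = card D"
    using orient bij_betw_same_card by (fastforce simp: orientation_def)
  with orient is_norm_r_norm show ?thesis
    unfolding weakly_norming_def by blast
qed

end
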